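(* Let $M$ be a finitely generated, integral, cancellative, torsion-free normal binoid, regular in codimension $1$, of dimension $2$. Then $\operatorname{Pic}^{\mathrm{loc}}(M\wedge\mathbb N^\infty)=0$.
   Context: A (commutative) binoid is a commutative monoid $(M,+,0)$ with an absorbing element $\infty$; $M^\bullet=M\smallsetminus\{\infty\}$ and $M^*$ is the group of units. It is integral if $M^\bullet$ is a submonoid, cancellative if $a+b=a+c\neq\infty$ implies $b=c$, torsion-free if $na=nb\neq\infty$ with $n\geq1$ implies $a=b$. For $M$ integral and cancellative, $\Gamma^\bullet=-M^\bullet+M^\bullet$ is the difference group, and $M$ is normal if $\gamma\in\Gamma^\bullet$ and $n\gamma\in M^\bullet$ for some $n\geq1$ imply $\gamma\in M^\bullet$. For a monoid $N$, $N^\infty=N\cup\{\infty\}$ is the binoid obtained by adjoining an absorbing element. The smash product $M\wedge N$ of binoids is $(M\times N)/\!\sim$, where all pairs with at least one entry equal to $\infty$ are identified to a single element $\infty$, with componentwise addition. A prime ideal is a subset $\mathfrak p\ni\infty$ with $\mathfrak p+M\subseteq\mathfrak p$ and $M\smallsetminus\mathfrak p$ a submonoid. $\operatorname{Spec}M$ is the set of prime ideals, with basis of open sets $D(f)=\{\mathfrak p\mid f\notin\mathfrak p\}$; it has a unique maximal element $M_+=M\smallsetminus M^*$. The punctured spectrum is $\operatorname{Spec}^\bullet M=\operatorname{Spec}M\smallsetminus\{M_+\}$. The height of a prime ideal is the maximal length $n$ of a strictly increasing chain $\mathfrak p_0\subsetneq\dots\subsetneq\mathfrak p_n=\mathfrak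 p$ of prime ideals; the dimension of $M$ is the maximal height of a prime ideal. $M_{\mathfrak p}$ is the localization of $M$ at the submonoid $M\smallsetminus\mathfrak p$. A binoid is regular if it is isomorphic to $G^\infty\wedge(\mathbb N^s)^\infty$ for some abelian group $G$ and $s\in\mathbb N$; $M$ is regular in codimension $1$ if $M_{\mathfrak p}$ is regular for every prime ideal $\mathfrak p$ of height at most $1$. The structure sheaf $\mathcal O_M$ on $\operatorname{Spec}M$ is the sheaf of binoids with $\mathcal O_M(D(f))=M_f$. For an open subset $U$, $\operatorname{Pic}(U)$ is the group of isomorphism classes of sheaves of $\mathcal O_M|_U$-sets locally isomorphic to $\mathcal O_M|_U$, under the smash product over $\mathcal O_M|_U$; it is isomorphic to $\mathrm H^1(U,\mathcal O_M^*|_U)$, where $\mathcal O_M^*$ is the sheaf of units. The local Picard group is $\operatorname{Pic}^{\mathrm{loc}}(M)=\operatorname{Pic}(\operatorname{Spec}^\bullet M)$. *)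

theory Defs
  imports
    "HOL-Analysis.Analysis"
    "HOL-Algebra.Elementary_Groups"
    "HOL-Algebra.Product_Groups"
    "HOL-Library.Extended_Nat"
begin

section \<open>Binoids\<close>

text \<open>
  Binoids are written multiplicatively, following HOL-Algebra: the operation is \<open>\<otimes>\<close>, its
  neutral element (the \<open>0\<close> of additive notation) is \<open>\<one>\<close>, the multiple \<open>n a\<close> is \<open>a [^] n\<close>,
  and the absorbing element \<open>\<infinity>\<close> is the record field \<open>absorb\<close>.
\<close>

record 'a binoid = "'a monoid" +
  absorb :: 'a

locale binoid = comm_monoid M for M :: "('a, 'z) binoid_scheme" (structure) +
  assumes absorb_closed: "absorb M \<in> carrier M"
    and absorb_mult: "a \<in> carrier M \<Longrightarrow> absorb M \<otimes> a = absorb M"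

definition nonabsorb :: "('a, 'z) binoid_scheme \<Rightarrow> 'a set" where
  "nonabsorb M = carrier M - {absorb M}"

definition binoid_isomorphic :: "('a, 'z) binoid_scheme \<Rightarrow> ('b, 'y) binoid_scheme \<Rightarrow> bool" where
  "binoid_isomorphic M N \<longleftrightarrow>
     (\<exists>h \<in> iso M N. h \<one>\<^bsub>M\<^esub> = \<one>\<^bsub>N\<^esub> \<and> h (absorb M) = absorb N)"

text \<open>The absorbing element may always be added to \<open>A\<close>, so it makes no difference whether it
  has to be generated.\<close>

definition finitely_generated :: "('a, 'z) binoid_scheme \<Rightarrow> bool" where
  "finitely_generated M \<longleftrightarrow>
     (\<exists>A. finite A \<and> A \<subseteq> carrier M \<and> (\<forall>H. submonoid H M \<and> A \<subseteq> H \<longrightarrow> carrier M \<subseteq> H))"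

definition integral_binoid :: "('a, 'z) binoid_scheme \<Rightarrow> bool" where
  "integral_binoid M \<longleftrightarrow> submonoid (nonabsorb M) M"

definition cancellative :: "('a, 'z) binoid_scheme \<Rightarrow> bool" where
  "cancellative M \<longleftrightarrow>
     (\<forall>a\<in>carrier M. \<forall>b\<in>carrier M. \<forall>c\<in>carrier M.
        a \<otimes>\<^bsub>M\<^esub> b = a \<otimes>\<^bsub>M\<^esub> c \<and> a \<otimes>\<^bsub>M\<^esub> c \<noteq> absorb M \<longrightarrow> b = c)"

definition torsion_free :: "('a, 'z) binoid_scheme \<Rightarrow> bool" where
  "torsion_free M \<longleftrightarrow>
     (\<forall>a\<in>carrier M. \<forall>b\<in>carrier M. \<forall>n::nat.
        1 \<le> n \<and> a [^]\<^bsub>M\<^esub> n = b [^]\<^bsub>M\<^esub> n \<and> b [^]\<^bsub>M\<^esub> n \<noteq> absorb M \<longrightarrow> a = b)"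

definition quotient_binoid ::
    "('a, 'z) binoid_scheme \<Rightarrow> ('a \<times> 'a) set \<Rightarrow> 'a set binoid" where
  "quotient_binoid M r =
     \<lparr>carrier = carrier M // r,
      mult = (\<lambda>X Y. \<Union>x\<in>X. \<Union>y\<in>Y. r `` {x \<otimes>\<^bsub>M\<^esub> y}),
      one = r `` {\<one>\<^bsub>M\<^esub>},
      absorb = r `` {absorb M}\<rparr>"

subsection \<open>Localization\<close>

text \<open>A pair \<open>(a, s)\<close> stands for the formal difference \<open>a - s\<close> (additively).\<close>

definition loc_pairs :: "('a, 'z) binoid_scheme \<Rightarrow> 'a set \<Rightarrow> ('a \<times> 'a) binoid" where
  "loc_pairs M S =
     \<lparr>carrier = carrier M \<times> S,
      mult = (\<lambda>x y. (fst x \<otimes>\<^bsub>M\<^esub> fst y, snd x \<otimes>\<^bsub>M\<^esub> snd y)),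
      one = (\<one>\<^bsub>M\<^esub>, \<one>\<^bsub>M\<^esub>),
      absorb = (absorb M, \<one>\<^bsub>M\<^esub>)\<rparr>"

definition loc_rel :: "('a, 'z) binoid_scheme \<Rightarrow> 'a set \<Rightarrow> (('a \<times> 'a) \<times> ('a \<times> 'a)) set" where
  "loc_rel M S =
     {((a, s), (b, t)). a \<in> carrier M \<and> s \<in> S \<and> b \<in> carrier M \<and> t \<in> S \<and>
        (\<exists>u\<in>S. u \<otimes>\<^bsub>M\<^esub> (a \<otimes>\<^bsub>M\<^esub> t) = u \<otimes>\<^bsub>M\<^esub> (b \<otimes>\<^bsub>M\<^esub> s))}"

definition fraction :: "('a, 'z) binoid_scheme \<Rightarrow> 'a set \<Rightarrow> 'a \<Rightarrow> 'a \<Rightarrow> ('a \<times> 'a) set" where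
  "fraction M S a s = loc_rel M S `` {(a, s)}"

definition localization ::
    "('a, 'z) binoid_scheme \<Rightarrow> 'a set \<Rightarrow> ('a \<times> 'a) set binoid" where
  "localization M S = quotient_binoid (loc_pairs M S) (loc_rel M S)"

text \<open>For \<open>M\<close> integral and cancellative, the difference group is
  \<open>nonabsorb (localization M (nonabsorb M))\<close>, and \<open>M\<close> embeds by \<open>a \<mapsto> a - 0\<close>.\<close>

definition normal_binoid :: "('a, 'z) binoid_scheme \<Rightarrow> bool" where
  "normal_binoid M \<longleftrightarrow>
     (let \<Gamma> = localization M (nonabsorb M);
          M' = (\<lambda>a. fraction M (nonabsorb M) a \<one>\<^bsub>M\<^esub>) ` nonabsorb M
      in \<forall>g \<in> nonabsorb \<Gamma>. \<forall>n::nat. 1 \<le> n \<and> g [^]\<^bsub>\<Gamma>\<^esub> n \<in> M' \<longrightarrow> g \<in> M')"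

subsection \<open>Adjoining an absorbing element; smash products\<close>

definition adjoin_absorb :: "('a, 'z) monoid_scheme \<Rightarrow> 'a option binoid" where
  "adjoin_absorb N =
     \<lparr>carrier = insert None (Some ` carrier N),
      mult = (\<lambda>x y. case (x, y) of (Some a, Some b) \<Rightarrow> Some (a \<otimes>\<^bsub>N\<^esub> b) | _ \<Rightarrow> None),
      one = Some \<one>\<^bsub>N\<^esub>,
      absorb = None\<rparr>"

definition prod_binoid ::
    "('a, 'z) binoid_scheme \<Rightarrow> ('b, 'y) binoid_scheme \<Rightarrow> ('a \<times> 'b) binoid" where
  "prod_binoid M N =
     \<lparr>carrier = carrier M \<times> carrier N,
      mult = (\<lambda>x y. (fst x \<otimes>\<^bsub>M\<^esub> fst y, snd x \<otimes>\<^bsub>N\<^esub> snd y)),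
      one = (\<one>\<^bsub>M\<^esub>, \<one>\<^bsub>N\<^esub>),
      absorb = (absorb M, absorb N)\<rparr>"

definition smash_rel ::
    "('a, 'z) binoid_scheme \<Rightarrow> ('b, 'y) binoid_scheme \<Rightarrow> (('a \<times> 'b) \<times> ('a \<times> 'b)) set" where
  "smash_rel M N =
     {((a, b), (a', b')). a \<in> carrier M \<and> b \<in> carrier N \<and> a' \<in> carrier M \<and> b' \<in> carrier N \<and>
        ((a, b) = (a', b') \<or>
         (a = absorb M \<or> b = absorb N) \<and> (a' = absorb M \<or> b' = absorb N))}"

definition smash ::
    "('a, 'z) binoid_scheme \<Rightarrow> ('b, 'y) binoid_scheme \<Rightarrow> ('a \<times> 'b) set binoid" where
  "smash M N = quotient_binoid (prod_binoid M N) (smash_rel M N)"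

definition nat_monoid :: "nat monoid" where
  "nat_monoid = \<lparr>carrier = UNIV, mult = (+), one = 0\<rparr>"

text \<open>Such a \<open>G\<close> is isomorphic to the unit group of \<open>M\<close>, so nothing is lost by taking its
  elements in the type of those of \<open>M\<close>.\<close>

definition regular_binoid :: "('a, 'z) binoid_scheme \<Rightarrow> bool" where
  "regular_binoid M \<longleftrightarrow>
     (\<exists>(G :: 'a monoid) s::nat. comm_group G \<and>
        binoid_isomorphic M
          (smash (adjoin_absorb G) (adjoin_absorb (product_group {..<s} (\<lambda>_. nat_monoid)))))"

section \<open>The spectrum\<close>

definition prime_ideal :: "('a, 'z) binoid_scheme \<Rightarrow> 'a set \<Rightarrow> bool" where
  "prime_ideal M P \<longleftrightarrow>
     P \<subseteq> carrier M \<and> absorb M \<in> P \<and> (\<forall>a\<in>P. \<forall>x\<in>carrier M. a \<otimes>\<^bsub>M\<^esub> x \<in> P) \<and>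
     submonoid (carrier M - P) M"

definition basic_open :: "('a, 'z) binoid_scheme \<Rightarrow> 'a \<Rightarrow> 'a set set" where
  "basic_open M f = {P. prime_ideal M P \<and> f \<notin> P}"

definition Spec :: "('a, 'z) binoid_scheme \<Rightarrow> 'a set topology" where
  "Spec M = topology_generated_by (basic_open M ` carrier M)"

definition punctured :: "('a, 'z) binoid_scheme \<Rightarrow> 'a set set" where
  "punctured M = {P. prime_ideal M P} - {carrier M - Units M}"

definition height :: "('a, 'z) binoid_scheme \<Rightarrow> 'a set \<Rightarrow> enat" where
  "height M P =
     Sup {enat n | n. \<exists>c :: nat \<Rightarrow> 'a set.
            (\<forall>i\<le>n. prime_ideal M (c i)) \<and> (\<forall>i<n. c i \<subset> c (Suc i)) \<and> c n = P}"

definition binoid_dim :: "('a, 'z) binoid_scheme \<Rightarrow> enat" where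
  "binoid_dim M = Sup (height M ` {P. prime_ideal M P})"

definition stalk :: "('a, 'z) binoid_scheme \<Rightarrow> 'a set \<Rightarrow> ('a \<times> 'a) set binoid" where
  "stalk M P = localization M (carrier M - P)"

definition regular_in_codim_one :: "('a, 'z) binoid_scheme \<Rightarrow> bool" where
  "regular_in_codim_one M \<longleftrightarrow>
     (\<forall>P. prime_ideal M P \<and> height M P \<le> 1 \<longrightarrow> regular_binoid (stalk M P))"

section \<open>Sheaves\<close>

text \<open>
  Presheaves carry arbitrary values outside the open sets of the space at hand. Sheaves on an
  open subspace \<open>U\<close> of \<open>X\<close> are sheaves on \<open>subtopology X U\<close>, and restricting a sheaf to \<open>U\<close>
  leaves the record unchanged.
\<close>

record ('p, 'm) binoid_presheaf =
  bsec :: "'p set \<Rightarrow> 'm binoid"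
  bres :: "'p set \<Rightarrow> 'p set \<Rightarrow> 'm \<Rightarrow> 'm"

text \<open>
  The sections over \<open>V\<close> are the families of germs that are locally given by one fraction. As
  \<open>D(f)\<close> has a greatest element, the largest prime ideal not containing \<open>f\<close>, whose only
  neighbourhood in \<open>D(f)\<close> is \<open>D(f)\<close> itself, this is the sheaf with value \<open>M\<^sub>f\<close> on \<open>D(f)\<close>.
\<close>

definition structure_sheaf ::
    "('a, 'z) binoid_scheme \<Rightarrow> ('a set, 'a set \<Rightarrow> ('a \<times> 'a) set) binoid_presheaf" where
  "structure_sheaf M =
     \<lparr>bsec = (\<lambda>V.
        \<lparr>carrier = {s \<in> (\<Pi>\<^sub>E P\<in>V. carrier (stalk M P)).
            \<forall>P\<in>V. \<exists>a\<in>carrier M. \<exists>f\<in>carrier M. P \<in> basic_open M f \<and> basic_open M f \<subseteq> V \<and>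
              (\<forall>Q\<in>basic_open M f. s Q = fraction M (carrier M - Q) a f)},
         mult = (\<lambda>s t. \<lambda>P\<in>V. s P \<otimes>\<^bsub>stalk M P\<^esub> t P),
         one = (\<lambda>P\<in>V. \<one>\<^bsub>stalk M P\<^esub>),
         absorb = (\<lambda>P\<in>V. absorb (stalk M P))\<rparr>),
      bres = (\<lambda>V W s. restrict s W)\<rparr>"

text \<open>Presheaves of pointed sets with an action of a presheaf of binoids.\<close>

record ('p, 'm, 's) act_presheaf =
  sec :: "'p set \<Rightarrow> 's set"
  res :: "'p set \<Rightarrow> 'p set \<Rightarrow> 's \<Rightarrow> 's"
  act :: "'p set \<Rightarrow> 'm \<Rightarrow> 's \<Rightarrow> 's"
  pt :: "'p set \<Rightarrow> 's"

definition binoid_act ::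
    "('m, 'z) binoid_scheme \<Rightarrow> 's set \<Rightarrow> ('m \<Rightarrow> 's \<Rightarrow> 's) \<Rightarrow> 's \<Rightarrow> bool" where
  "binoid_act M S \<alpha> p \<longleftrightarrow>
     p \<in> S \<and> (\<forall>a\<in>carrier M. \<forall>s\<in>S. \<alpha> a s \<in> S) \<and>
     (\<forall>s\<in>S. \<alpha> \<one>\<^bsub>M\<^esub> s = s) \<and> (\<forall>s\<in>S. \<alpha> (absorb M) s = p) \<and> (\<forall>a\<in>carrier M. \<alpha> a p = p) \<and>
     (\<forall>a\<in>carrier M. \<forall>b\<in>carrier M. \<forall>s\<in>S. \<alpha> (a \<otimes>\<^bsub>M\<^esub> b) s = \<alpha> a (\<alpha> b s))"

definition presheaf_of_sets :: "'p topology \<Rightarrow> ('p, 'm, 's) act_presheaf \<Rightarrow> bool" where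
  "presheaf_of_sets X F \<longleftrightarrow>
     (\<forall>V W. openin X V \<and> openin X W \<and> W \<subseteq> V \<longrightarrow> res F V W \<in> sec F V \<rightarrow> sec F W) \<and>
     (\<forall>V. openin X V \<longrightarrow> (\<forall>s\<in>sec F V. res F V V s = s)) \<and>
     (\<forall>V W Z. openin X V \<and> openin X W \<and> openin X Z \<and> Z \<subseteq> W \<and> W \<subseteq> V \<longrightarrow>
        (\<forall>s\<in>sec F V. res F W Z (res F V W s) = res F V Z s))"

definition gluing_axiom :: "'p topology \<Rightarrow> ('p, 'm, 's) act_presheaf \<Rightarrow> bool" where
  "gluing_axiom X F \<longleftrightarrow>
     (\<forall>\<W> \<sigma>. (\<forall>W\<in>\<W>. openin X W \<and> \<sigma> W \<in> sec F W) \<and>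
        (\<forall>W\<in>\<W>. \<forall>W'\<in>\<W>. res F W (W \<inter> W') (\<sigma> W) = res F W' (W \<inter> W') (\<sigma> W')) \<longrightarrow>
        (\<exists>!s. s \<in> sec F (\<Union>\<W>) \<and> (\<forall>W\<in>\<W>. res F (\<Union>\<W>) W s = \<sigma> W)))"

definition sheaf_of_act_sets ::
    "'p topology \<Rightarrow> ('p, 'm) binoid_presheaf \<Rightarrow> ('p, 'm, 's) act_presheaf \<Rightarrow> bool" where
  "sheaf_of_act_sets X \<O> F \<longleftrightarrow>
     presheaf_of_sets X F \<and> gluing_axiom X F \<and>
     (\<forall>V. openin X V \<longrightarrow> binoid_act (bsec \<O> V) (sec F V) (act F V) (pt F V)) \<and>
     (\<forall>V W. openin X V \<and> openin X W \<and> W \<subseteq> V \<longrightarrow>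
        res F V W (pt F V) = pt F W \<and>
        (\<forall>a\<in>carrier (bsec \<O> V). \<forall>s\<in>sec F V.
           res F V W (act F V a s) = act F W (bres \<O> V W a) (res F V W s)))"

definition act_presheaf_hom ::
    "'p topology \<Rightarrow> ('p, 'm) binoid_presheaf \<Rightarrow> ('p, 'm, 's) act_presheaf \<Rightarrow>
     ('p, 'm, 't) act_presheaf \<Rightarrow> ('p set \<Rightarrow> 's \<Rightarrow> 't) \<Rightarrow> bool" where
  "act_presheaf_hom X \<O> F G \<theta> \<longleftrightarrow>
     (\<forall>V. openin X V \<longrightarrow>
        \<theta> V \<in> sec F V \<rightarrow> sec G V \<and> \<theta> V (pt F V) = pt G V \<and>
        (\<forall>a\<in>carrier (bsec \<O> V). \<forall>s\<in>sec F V. \<theta> V (act F V a s) = act G V a (\<theta> V s))) \<and>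
     (\<forall>V W. openin X V \<and> openin X W \<and> W \<subseteq> V \<longrightarrow>
        (\<forall>s\<in>sec F V. \<theta> W (res F V W s) = res G V W (\<theta> V s)))"

definition act_presheaf_isomorphic ::
    "'p topology \<Rightarrow> ('p, 'm) binoid_presheaf \<Rightarrow> ('p, 'm, 's) act_presheaf \<Rightarrow>
     ('p, 'm, 't) act_presheaf \<Rightarrow> bool" where
  "act_presheaf_isomorphic X \<O> F G \<longleftrightarrow>
     (\<exists>\<theta>. act_presheaf_hom X \<O> F G \<theta> \<and>
        (\<forall>V. openin X V \<longrightarrow> bij_betw (\<theta> V) (sec F V) (sec G V)))"

definition regular_act :: "('p, 'm) binoid_presheaf \<Rightarrow> ('p, 'm, 'm) act_presheaf" where
  "regular_act \<O> =
     \<lparr>sec = (\<lambda>V. carrier (bsec \<O> V)), res = bres \<O>,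
      act = (\<lambda>V. mult (bsec \<O> V)), pt = (\<lambda>V. absorb (bsec \<O> V))\<rparr>"

definition invertible_sheaf ::
    "'p topology \<Rightarrow> ('p, 'm) binoid_presheaf \<Rightarrow> ('p, 'm, 's) act_presheaf \<Rightarrow> bool" where
  "invertible_sheaf X \<O> F \<longleftrightarrow>
     sheaf_of_act_sets X \<O> F \<and>
     (\<forall>p\<in>topspace X. \<exists>V. openin X V \<and> p \<in> V \<and>
        act_presheaf_isomorphic (subtopology X V) \<O> F (regular_act \<O>))"

subsection \<open>Smash products of sheaves\<close>

definition act_smash_gen ::
    "('p, 'm) binoid_presheaf \<Rightarrow> ('p, 'm, 's) act_presheaf \<Rightarrow> ('p, 'm, 't) act_presheaf \<Rightarrow>
     'p set \<Rightarrow> (('s \<times> 't) \<times> ('s \<times> 't)) set" where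
  "act_smash_gen \<O> F G V =
     {((act F V a s, t), (s, act G V a t)) | a s t.
        a \<in> carrier (bsec \<O> V) \<and> s \<in> sec F V \<and> t \<in> sec G V} \<union>
     {((s, t), (s', t')). s \<in> sec F V \<and> t \<in> sec G V \<and> s' \<in> sec F V \<and> t' \<in> sec G V \<and>
        (s = pt F V \<or> t = pt G V) \<and> (s' = pt F V \<or> t' = pt G V)}"

definition act_smash_rel ::
    "('p, 'm) binoid_presheaf \<Rightarrow> ('p, 'm, 's) act_presheaf \<Rightarrow> ('p, 'm, 't) act_presheaf \<Rightarrow>
     'p set \<Rightarrow> (('s \<times> 't) \<times> ('s \<times> 't)) set" where
  "act_smash_rel \<O> F G V =
     (act_smash_gen \<O> F G V \<union> (act_smash_gen \<O> F G V)\<inverse>)\<^sup>* \<inter>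
     (sec F V \<times> sec G V) \<times> (sec F V \<times> sec G V)"

text \<open>The presheaf with value \<open>F(V) \<and> G(V)\<close> over \<open>\<O>(V)\<close>.\<close>

definition act_smash ::
    "('p, 'm) binoid_presheaf \<Rightarrow> ('p, 'm, 's) act_presheaf \<Rightarrow> ('p, 'm, 't) act_presheaf \<Rightarrow>
     ('p, 'm, ('s \<times> 't) set) act_presheaf" where
  "act_smash \<O> F G =
     \<lparr>sec = (\<lambda>V. (sec F V \<times> sec G V) // act_smash_rel \<O> F G V),
      res = (\<lambda>V W X. \<Union>x\<in>X. act_smash_rel \<O> F G W `` {(res F V W (fst x), res G V W (snd x))}),
      act = (\<lambda>V a X. \<Union>x\<in>X. act_smash_rel \<O> F G V `` {(act F V a (fst x), snd x)}),
      pt = (\<lambda>V. act_smash_rel \<O> F G V `` {(pt F V, pt G V)})\<rparr>"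

text \<open>A morphism from a presheaf to a sheaf exhibits the latter as the sheafification of the
  former iff it is locally injective and locally surjective.\<close>

definition is_sheafification ::
    "'p topology \<Rightarrow> ('p, 'm) binoid_presheaf \<Rightarrow> ('p, 'm, 's) act_presheaf \<Rightarrow>
     ('p, 'm, 't) act_presheaf \<Rightarrow> bool" where
  "is_sheafification X \<O> F G \<longleftrightarrow>
     sheaf_of_act_sets X \<O> G \<and>
     (\<exists>\<theta>. act_presheaf_hom X \<O> F G \<theta> \<and>
        (\<forall>V s s'. openin X V \<and> s \<in> sec F V \<and> s' \<in> sec F V \<and> \<theta> V s = \<theta> V s' \<longrightarrow>
           (\<forall>p\<in>V. \<exists>W. openin X W \<and> p \<in> W \<and> W \<subseteq> V \<and> res F V W s = res F V W s')) \<and>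
        (\<forall>V t. openin X V \<and> t \<in> sec G V \<longrightarrow>
           (\<forall>p\<in>V. \<exists>W. openin X W \<and> p \<in> W \<and> W \<subseteq> V \<and> (\<exists>s\<in>sec F W. \<theta> W s = res G V W t))))"

section \<open>The Picard group\<close>

text \<open>
  HOL has no type of all sheaves, so isomorphism classes are formed among the sheaves with
  sections in \<open>'m + 'c\<close>. The type \<open>'c\<close> is arbitrary, so every sheaf with sections in any type
  \<open>'c\<close> occurs up to isomorphism; the summand \<open>'m\<close> makes room for \<open>\<O>\<close> itself.
  The product of two classes is the class of the sheafified smash product of representatives,
  as a set: all the invertible sheaves that are a sheafification of such a smash product.
\<close>

definition Pic ::
    "'c itself \<Rightarrow> 'p topology \<Rightarrow> ('p, 'm) binoid_presheaf \<Rightarrow>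
     ('p, 'm, 'm + 'c) act_presheaf set monoid" where
  "Pic _ X \<O> =
     \<lparr>carrier = {L. invertible_sheaf X \<O> L} //
        {(L, L'). invertible_sheaf X \<O> L \<and> invertible_sheaf X \<O> L' \<and>
                  act_presheaf_isomorphic X \<O> L L'},
      mult = (\<lambda>A B. {L. invertible_sheaf X \<O> L \<and>
        (\<exists>F\<in>A. \<exists>G\<in>B. is_sheafification X \<O> (act_smash \<O> F G) L)}),
      one = {L. invertible_sheaf X \<O> L \<and> act_presheaf_isomorphic X \<O> L (regular_act \<O>)}\<rparr>"

definition Pic_loc ::
    "'c itself \<Rightarrow> ('a, 'z) binoid_scheme \<Rightarrow>
     ('a set, 'a set \<Rightarrow> ('a \<times> 'a) set, ('a set \<Rightarrow> ('a \<times> 'a) set) + 'c) act_presheaf set monoid"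
  where
  "Pic_loc _ M = Pic TYPE('c) (subtopology (Spec M) (punctured M)) (structure_sheaf M)"

end

theory Submission
  imports Defs "HOL-Algebra.Divisibility"
begin

text \<open>
  In \<open>B = M \<and> \<nat>\<^sup>\<infinity>\<close> the generator \<open>x\<close> of \<open>\<nat>\<close> is
  a prime element, and every element other than \<open>\<infinity>\<close> is uniquely a power of \<open>x\<close> times an element
  not divisible by \<open>x\<close>. Let \<open>F\<close> be an invertible sheaf on an open set containing \<open>D(x)\<close>. As \<open>D(x)\<close>
  has a greatest point, \<open>F\<close> has a generator \<open>e\<close> over \<open>D(x)\<close>. A point outside \<open>D(x)\<close> has a
  neighbourhood \<open>D(f)\<close> with \<open>x\<close> not dividing \<open>f\<close> and with a generator over \<open>D(f)\<close>; on \<open>D(f x)\<close> it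
  differs from \<open>e\<close> by a unit, that is, by a unit of \<open>D(f)\<close> times a power of \<open>x\<close>. Absorbing the former
  into the local generator leaves a power of \<open>x\<close>, whose exponent does not depend on the point, since
  units over \<open>D(f g)\<close> are prime to \<open>x\<close>. After scaling \<open>e\<close> by that power all the generators agree
  and glue to a global one.
\<close>

section \<open>Invertible sheaves and generators\<close>

text \<open>The obstacle is to find local generators that agree on all overlaps at once, since each
  of them is only determined up to a unit. Fixing the transition to \<open>e\<close> to be a pure
  power of \<open>x\<close> removes this freedom: two generators normalized in this way differ by a
  unit that becomes one after inverting \<open>x\<close>, and restriction between basic open sets of
  nonabsorbing elements loses nothing, because all of them contain the generic point
  \<open>{absorb M}\<close>. So the normalized generator over \<open>D f\<close> is unique, and all
  of them can be glued together without any choice and without forming cocycles. The overview stops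
  at a global generator. A sheaf that has one is isomorphic to \<open>\<O>\<close>, so there is only
  one isomorphism class; and the product of two multiples of the generator makes the sheaf a
  sheafification of its own smash square, so this class is its own square. For the punctured
  spectrum the requirement that \<open>D x\<close> lie in the open set holds because
  \<open>x\<close> is not a unit.\<close>

locale binoid_sheaf =
  fixes X :: "'p topology" and \<O> :: "('p, 'm) binoid_presheaf"
  assumes binoid_bsec: "openin X V \<Longrightarrow> binoid (bsec \<O> V)"
    and sheaf_regular: "sheaf_of_act_sets X \<O> (regular_act \<O>)"
    and bres_one:
      "openin X V \<Longrightarrow> openin X W \<Longrightarrow> W \<subseteq> V \<Longrightarrow> bres \<O> V W \<one>\<^bsub>bsec \<O> V\<^esub> = \<one>\<^bsub>bsec \<O> W\<^esub>"

locale act_sheaf = binoid_sheaf X \<O>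
  for X :: "'p topology" and \<O> :: "('p, 'm) binoid_presheaf" +
  fixes F :: "('p, 'm, 's) act_presheaf"
  assumes sheaf: "sheaf_of_act_sets X \<O> F"
begin

lemma res_closed:
  assumes "openin X V" "openin X W" "W \<subseteq> V" "s \<in> sec F V"
  shows "res F V W s \<in> sec F W"
  using sheaf assms by (simp add: sheaf_of_act_sets_def presheaf_of_sets_def Pi_iff)

lemma res_self: "openin X V \<Longrightarrow> s \<in> sec F V \<Longrightarrow> res F V V s = s"
  using sheaf by (simp add: sheaf_of_act_sets_def presheaf_of_sets_def)

lemma res_res:
  assumes "openin X V" "openin X W" "openin X Z" "Z \<subseteq> W" "W \<subseteq> V" "s \<in> sec F V"
  shows "res F W Z (res F V W s) = res F V Z s"
  using sheaf assms by (simp add: sheaf_of_act_sets_def presheaf_of_sets_def)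

lemma binoid_act: "openin X V \<Longrightarrow> binoid_act (bsec \<O> V) (sec F V) (act F V) (pt F V)"
  using sheaf by (simp add: sheaf_of_act_sets_def)

lemma
  assumes "openin X V"
  shows pt_closed: "pt F V \<in> sec F V"
    and act_closed: "a \<in> carrier (bsec \<O> V) \<Longrightarrow> s \<in> sec F V \<Longrightarrow> act F V a s \<in> sec F V"
    and act_one: "s \<in> sec F V \<Longrightarrow> act F V \<one>\<^bsub>bsec \<O> V\<^esub> s = s"
    and act_absorb: "s \<in> sec F V \<Longrightarrow> act F V (absorb (bsec \<O> V)) s = pt F V"
    and act_pt: "a \<in> carrier (bsec \<O> V) \<Longrightarrow> act F V a (pt F V) = pt F V"
    and act_mult: "a \<in> carrier (bsec \<O> V) \<Longrightarrow> b \<in> carrier (bsec \<O> V) \<Longrightarrow> s \<in> sec F V \<Longrightarrow>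
           act F V (a \<otimes>\<^bsub>bsec \<O> V\<^esub> b) s = act F V a (act F V b s)"
  using binoid_act[OF assms] unfolding binoid_act_def by simp_all

lemma res_pt: "openin X V \<Longrightarrow> openin X W \<Longrightarrow> W \<subseteq> V \<Longrightarrow> res F V W (pt F V) = pt F W"
  using sheaf by (simp add: sheaf_of_act_sets_def)

lemma res_act:
  assumes "openin X V" "openin X W" "W \<subseteq> V" "a \<in> carrier (bsec \<O> V)" "s \<in> sec F V"
  shows "res F V W (act F V a s) = act F W (bres \<O> V W a) (res F V W s)"
  using sheaf assms by (simp add: sheaf_of_act_sets_def)

lemma gluing:
  assumes "\<And>W. W \<in> \<W> \<Longrightarrow> openin X W" "\<And>W. W \<in> \<W> \<Longrightarrow> \<sigma> W \<in> sec F W"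
    and "\<And>W W'. W \<in> \<W> \<Longrightarrow> W' \<in> \<W> \<Longrightarrow> res F W (W \<inter> W') (\<sigma> W) = res F W' (W \<inter> W') (\<sigma> W')"
  shows "\<exists>!s. s \<in> sec F (\<Union>\<W>) \<and> (\<forall>W\<in>\<W>. res F (\<Union>\<W>) W s = \<sigma> W)"
proof -
  have "gluing_axiom X F" using sheaf by (simp add: sheaf_of_act_sets_def)
  then show ?thesis
    unfolding gluing_axiom_def by (elim allE[of _ \<W>] allE[of _ \<sigma>] impE) (use assms in blast)+
qed

text \<open>The uniqueness half of the gluing axiom, applied to the family of restrictions of
  \<open>s\<close> itself.\<close>

lemma separated:
  assumes \<W>: "\<And>W. W \<in> \<W> \<Longrightarrow> openin X W" and s: "s \<in> sec F (\<Union>\<W>)" and t: "t \<in> sec F (\<Union>\<W>)"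
    and eq: "\<And>W. W \<in> \<W> \<Longrightarrow> res F (\<Union>\<W>) W s = res F (\<Union>\<W>) W t"
  shows "s = t"
proof -
  have "openin X (\<Union>\<W>)" using \<W> by (rule openin_Union)
  then have "\<exists>!s'. s' \<in> sec F (\<Union>\<W>) \<and> (\<forall>W\<in>\<W>. res F (\<Union>\<W>) W s' = res F (\<Union>\<W>) W s)"
    using s \<W> by (intro gluing) (auto simp: res_closed res_res openin_Int Union_upper)
  with s t eq show ?thesis by metis
qed

end

context binoid_sheaf
begin

text \<open>Restriction, gluing and multiplicativity of \<open>\<O>\<close> are read off from
  \<open>\<O>\<close> acting on itself. Such an action says nothing about restricting one, hence the
  separate assumption \<open>bres_one\<close>.\<close>

sublocale reg: act_sheaf X \<O> "regular_act \<O>"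
  by unfold_locales (rule sheaf_regular)

lemma bres_closed:
  assumes "openin X V" "openin X W" "W \<subseteq> V" "a \<in> carrier (bsec \<O> V)"
  shows "bres \<O> V W a \<in> carrier (bsec \<O> W)"
  using reg.res_closed assms by (simp add: regular_act_def)

lemma bres_self: "openin X V \<Longrightarrow> a \<in> carrier (bsec \<O> V) \<Longrightarrow> bres \<O> V V a = a"
  using reg.res_self by (simp add: regular_act_def)

lemma bres_bres:
  assumes "openin X V" "openin X W" "openin X Z" "Z \<subseteq> W" "W \<subseteq> V" "a \<in> carrier (bsec \<O> V)"
  shows "bres \<O> W Z (bres \<O> V W a) = bres \<O> V Z a"
  using reg.res_res assms by (simp add: regular_act_def)

lemma bres_mult:
  assumes "openin X V" "openin X W" "W \<subseteq> V" "a \<in> carrier (bsec \<O> V)" "b \<in> carrier (bsec \<O> V)"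
  shows "bres \<O> V W (a \<otimes>\<^bsub>bsec \<O> V\<^esub> b) = bres \<O> V W a \<otimes>\<^bsub>bsec \<O> W\<^esub> bres \<O> V W b"
  using reg.res_act assms by (simp add: regular_act_def)

lemma bres_absorb:
  "openin X V \<Longrightarrow> openin X W \<Longrightarrow> W \<subseteq> V \<Longrightarrow> bres \<O> V W (absorb (bsec \<O> V)) = absorb (bsec \<O> W)"
  using reg.res_pt by (simp add: regular_act_def)

lemma comm_monoid_bsec: "openin X V \<Longrightarrow> comm_monoid (bsec \<O> V)"
  using binoid_bsec binoid.axioms(1) by blast

lemma monoid_bsec: "openin X V \<Longrightarrow> monoid (bsec \<O> V)"
  using comm_monoid_bsec comm_monoid.axioms(1) by blast

lemma one_bsec_closed: "openin X V \<Longrightarrow> \<one>\<^bsub>bsec \<O> V\<^esub> \<in> carrier (bsec \<O> V)"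
  by (simp add: monoid_bsec monoid.one_closed)

end

text \<open>A trivialization of \<open>F\<close> over \<open>V\<close>, recorded by the image of
  one. The bijection is demanded over every smaller open set, as an isomorphism of sheaves
  requires.\<close>

definition generator ::
    "'p topology \<Rightarrow> ('p, 'm) binoid_presheaf \<Rightarrow> ('p, 'm, 's) act_presheaf \<Rightarrow> 'p set \<Rightarrow> 's \<Rightarrow> bool" where
  "generator X \<O> F V e \<longleftrightarrow> e \<in> sec F V \<and>
     (\<forall>W. openin X W \<and> W \<subseteq> V \<longrightarrow>
        bij_betw (\<lambda>a. act F W a (res F V W e)) (carrier (bsec \<O> W)) (sec F W))"

context act_sheaf
begin

lemma generator_in_sec: "generator X \<O> F V e \<Longrightarrow> e \<in> sec F V"
  by (simp add: generator_def)

lemma generator_bij: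
  "generator X \<O> F V e \<Longrightarrow> openin X W \<Longrightarrow> W \<subseteq> V \<Longrightarrow>
     bij_betw (\<lambda>a. act F W a (res F V W e)) (carrier (bsec \<O> W)) (sec F W)"
  by (simp add: generator_def)

lemma generator_cancel:
  assumes "generator X \<O> F V e" "openin X V"
    and "a \<in> carrier (bsec \<O> V)" "b \<in> carrier (bsec \<O> V)" "act F V a e = act F V b e"
  shows "a = b"
  using generator_bij[OF assms(1,2) order_refl] assms res_self[OF assms(2)] generator_in_sec
  by (metis (no_types, lifting) bij_betw_imp_inj_on inj_onD)

lemma generator_spans:
  assumes "generator X \<O> F V e" "openin X V" "s \<in> sec F V"
  obtains a where "a \<in> carrier (bsec \<O> V)" "s = act F V a e"
  using generator_bij[OF assms(1,2) order_refl] assms res_self[OF assms(2)] generator_in_sec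
  by (metis (no_types, lifting) bij_betw_iff_bijections)

lemma generator_restrict:
  assumes e: "generator X \<O> F V e" and V: "openin X V" and W: "openin X W" "W \<subseteq> V"
  shows "generator X \<O> F W (res F V W e)"
  unfolding generator_def
proof (intro conjI allI impI)
  show "res F V W e \<in> sec F W" using assms by (simp add: res_closed generator_in_sec)
  fix Z assume Z: "openin X Z \<and> Z \<subseteq> W"
  then have "res F W Z (res F V W e) = res F V Z e"
    using V W e by (intro res_res) (auto simp: generator_in_sec)
  then show "bij_betw (\<lambda>a. act F Z a (res F W Z (res F V W e))) (carrier (bsec \<O> Z)) (sec F Z)"
    using generator_bij[OF e] Z W by auto
qed

text \<open>The unit is the transition function between two trivializations. Writing each generator
  in terms of the other shows that \<open>v \<otimes> u\<close> acts on \<open>e\<close> as one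
  does, and coefficients of a generator can be cancelled.\<close>

lemma generators_unit:
  assumes e: "generator X \<O> F V e" and e': "generator X \<O> F V e'" and V: "openin X V"
  obtains u where "u \<in> Units (bsec \<O> V)" "e' = act F V u e"
proof -
  interpret comm_monoid "bsec \<O> V" using V by (rule comm_monoid_bsec)
  obtain u where u: "u \<in> carrier (bsec \<O> V)" "e' = act F V u e"
    using generator_spans[OF e V generator_in_sec[OF e']] .
  obtain v where v: "v \<in> carrier (bsec \<O> V)" "e = act F V v e'"
    using generator_spans[OF e' V generator_in_sec[OF e]] .
  have "act F V (v \<otimes>\<^bsub>bsec \<O> V\<^esub> u) e = act F V \<one>\<^bsub>bsec \<O> V\<^esub> e"
    using V u(1) v(1) generator_in_sec[OF e]
    by (simp add: act_mult act_one u(2)[symmetric] v(2)[symmetric])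
  then have "v \<otimes>\<^bsub>bsec \<O> V\<^esub> u = \<one>\<^bsub>bsec \<O> V\<^esub>"
    using u(1) v(1) by (intro generator_cancel[OF e V]) auto
  then have "u \<in> Units (bsec \<O> V)"
    using u(1) v(1) m_comm[OF v(1) u(1)] unfolding Units_def by (auto intro!: bexI[of _ v])
  with u that show ?thesis by blast
qed

lemma generator_unit_act:
  assumes e: "generator X \<O> F V e" and u: "u \<in> Units (bsec \<O> V)" and V: "openin X V"
  shows "generator X \<O> F V (act F V u e)"
  unfolding generator_def
proof (intro conjI allI impI)
  interpret comm_monoid "bsec \<O> V" using V by (rule comm_monoid_bsec)
  have uc: "u \<in> carrier (bsec \<O> V)" using u by blast
  then show "act F V u e \<in> sec F V" using V e by (simp add: act_closed generator_in_sec)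
  obtain v where v: "v \<in> carrier (bsec \<O> V)" "v \<otimes>\<^bsub>bsec \<O> V\<^esub> u = \<one>\<^bsub>bsec \<O> V\<^esub>"
    using u unfolding Units_def by auto
  fix W assume W: "openin X W \<and> W \<subseteq> V"
  then interpret W: comm_monoid "bsec \<O> W" using comm_monoid_bsec by blast
  let ?u = "bres \<O> V W u" and ?v = "bres \<O> V W v" and ?e = "res F V W e"
  have e': "?e \<in> sec F W" using V W e by (simp add: res_closed generator_in_sec)
  have uv: "?u \<in> carrier (bsec \<O> W)" "?v \<in> carrier (bsec \<O> W)"
    using V W uc v by (auto intro: bres_closed)
  have vu: "?v \<otimes>\<^bsub>bsec \<O> W\<^esub> ?u = \<one>\<^bsub>bsec \<O> W\<^esub>"
    using V W uc v by (metis bres_mult bres_one)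
  \<comment> \<open>The coefficient map of the new generator is that of \<open>e\<close> after
    multiplication by the restricted unit, which the restriction of \<open>v\<close> undoes.\<close>
  have "bij_betw (\<lambda>a. a \<otimes>\<^bsub>bsec \<O> W\<^esub> ?u) (carrier (bsec \<O> W)) (carrier (bsec \<O> W))"
  proof (rule bij_betw_byWitness[where f' = "\<lambda>a. a \<otimes>\<^bsub>bsec \<O> W\<^esub> ?v"])
    show "\<forall>a\<in>carrier (bsec \<O> W). a \<otimes>\<^bsub>bsec \<O> W\<^esub> ?u \<otimes>\<^bsub>bsec \<O> W\<^esub> ?v = a"
      using uv vu by (simp add: W.m_assoc W.m_comm[of ?u])
    show "\<forall>a\<in>carrier (bsec \<O> W). a \<otimes>\<^bsub>bsec \<O> W\<^esub> ?v \<otimes>\<^bsub>bsec \<O> W\<^esub> ?u = a"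
      using uv vu by (simp add: W.m_assoc)
  qed (use uv in auto)
  from bij_betw_trans[OF this generator_bij[OF e]] W
  have "bij_betw ((\<lambda>a. act F W a ?e) \<circ> (\<lambda>a. a \<otimes>\<^bsub>bsec \<O> W\<^esub> ?u)) (carrier (bsec \<O> W)) (sec F W)"
    by blast
  moreover have "res F V W (act F V u e) = act F W ?u ?e"
    using V W uc e by (simp add: res_act generator_in_sec)
  ultimately show "bij_betw (\<lambda>a. act F W a (res F V W (act F V u e))) (carrier (bsec \<O> W)) (sec F W)"
    using uv e' W by (simp add: act_mult cong: bij_betw_cong)
qed

lemma generator_of_isomorphic:
  assumes V: "openin X V" and iso: "act_presheaf_isomorphic (subtopology X V) \<O> F (regular_act \<O>)"
  obtains e where "generator X \<O> F V e"
proof -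
  obtain \<theta> where hom: "act_presheaf_hom (subtopology X V) \<O> F (regular_act \<O>) \<theta>"
    and bij: "\<And>W. openin X W \<Longrightarrow> W \<subseteq> V \<Longrightarrow> bij_betw (\<theta> W) (sec F W) (carrier (bsec \<O> W))"
    using iso V unfolding act_presheaf_isomorphic_def
    by (auto simp: openin_open_subtopology regular_act_def)
  have \<theta>_act: "\<theta> W (act F W a s) = a \<otimes>\<^bsub>bsec \<O> W\<^esub> \<theta> W s"
    if "openin X W" "W \<subseteq> V" "a \<in> carrier (bsec \<O> W)" "s \<in> sec F W" for W a s
    using hom that V unfolding act_presheaf_hom_def
    by (auto simp: openin_open_subtopology regular_act_def)
  have \<theta>_res: "\<theta> W (res F V W s) = bres \<O> V W (\<theta> V s)"
    if "openin X W" "W \<subseteq> V" "s \<in> sec F V" for W s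
    using hom that V unfolding act_presheaf_hom_def
    by (auto simp: openin_open_subtopology regular_act_def)
  \<comment> \<open>The given isomorphism runs from \<open>F\<close> to \<open>\<O>\<close>, so the
    generator is the preimage of one, and acting on it inverts \<open>\<theta>\<close>.\<close>
  obtain e where e: "e \<in> sec F V" "\<theta> V e = \<one>\<^bsub>bsec \<O> V\<^esub>"
    using bij[OF V order_refl] one_bsec_closed[OF V] by (metis bij_betw_iff_bijections)
  have "generator X \<O> F V e"
    unfolding generator_def
  proof (intro conjI allI impI e)
    fix W assume W: "openin X W \<and> W \<subseteq> V"
    then interpret W: comm_monoid "bsec \<O> W" using comm_monoid_bsec by blast
    have eW: "res F V W e \<in> sec F W" using V W e by (simp add: res_closed)
    have inv: "\<theta> W (act F W a (res F V W e)) = a" if "a \<in> carrier (bsec \<O> W)" for a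
      using that W V e eW by (simp add: \<theta>_act \<theta>_res bres_one)
    have bijW: "bij_betw (\<theta> W) (sec F W) (carrier (bsec \<O> W))" using bij W by blast
    show "bij_betw (\<lambda>a. act F W a (res F V W e)) (carrier (bsec \<O> W)) (sec F W)"
    proof (rule bij_betw_byWitness[where f' = "\<theta> W"])
      show "\<forall>s\<in>sec F W. act F W (\<theta> W s) (res F V W e) = s"
      proof
        fix s assume s: "s \<in> sec F W"
        then have "\<theta> W s \<in> carrier (bsec \<O> W)" using bijW by (meson bij_betwE)
        then show "act F W (\<theta> W s) (res F V W e) = s"
          using bijW s eW W inv by (meson act_closed bij_betw_imp_inj_on inj_onD)
      qed
    qed (use inv eW W bijW in \<open>auto simp: act_closed dest: bij_betwE\<close>)
  qed
  then show ?thesis by (rule that)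
qed

text \<open>Injectivity holds because \<open>\<O>\<close> is separated. For surjectivity the local
  coefficients of a section are glued in \<open>\<O>\<close>; they agree on overlaps because a
  generator determines its coefficients.\<close>

lemma generator_local:
  assumes \<W>: "\<And>W. W \<in> \<W> \<Longrightarrow> openin X W" and e: "e \<in> sec F (\<Union>\<W>)"
    and gen: "\<And>W. W \<in> \<W> \<Longrightarrow> generator X \<O> F W (res F (\<Union>\<W>) W e)"
  shows "generator X \<O> F (\<Union>\<W>) e"
  unfolding generator_def
proof (intro conjI allI impI e)
  have U: "openin X (\<Union>\<W>)" using \<W> by (rule openin_Union)
  fix V assume V: "openin X V \<and> V \<subseteq> \<Union>\<W>"
  \<comment> \<open>The bijection is needed over every open \<open>V\<close>, which need not lie in
    one member of the cover, so the cover is cut down to \<open>V\<close>.\<close>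
  let ?\<V> = "(\<inter>) V ` \<W>" and ?e = "res F (\<Union>\<W>) V e"
  have cover: "\<Union>?\<V> = V" using V by auto
  have opn: "openin X W" if "W \<in> ?\<V>" for W using that V \<W> by auto
  have sub: "W \<subseteq> V" if "W \<in> ?\<V>" for W using that by auto
  have eV: "?e \<in> sec F V" using V U e by (simp add: res_closed)
  have genV: "generator X \<O> F W (res F V W ?e)" if W: "W \<in> ?\<V>" for W
  proof -
    obtain Z where Z: "Z \<in> \<W>" "W = V \<inter> Z" using W by auto
    have "generator X \<O> F W (res F Z W (res F (\<Union>\<W>) Z e))"
      using Z \<W> opn[OF W] by (intro generator_restrict[OF gen]) auto
    moreover have "res F Z W (res F (\<Union>\<W>) Z e) = res F V W (res F (\<Union>\<W>) V e)"
      using Z \<W> U V opn[OF W] e by (subst (1 2) res_res) auto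
    ultimately show ?thesis by simp
  qed
  show "bij_betw (\<lambda>a. act F V a ?e) (carrier (bsec \<O> V)) (sec F V)"
  proof (rule bij_betw_imageI)
    show "inj_on (\<lambda>a. act F V a ?e) (carrier (bsec \<O> V))"
    proof (rule inj_onI)
      fix a b assume a: "a \<in> carrier (bsec \<O> V)" and b: "b \<in> carrier (bsec \<O> V)"
        and eq: "act F V a ?e = act F V b ?e"
      have "bres \<O> V W a = bres \<O> V W b" if W: "W \<in> ?\<V>" for W
      proof (rule generator_cancel[OF genV[OF W] opn[OF W]])
        show "act F W (bres \<O> V W a) (res F V W ?e) = act F W (bres \<O> V W b) (res F V W ?e)"
          using eq a b V eV opn[OF W] sub[OF W] by (metis res_act)
      qed (use a b V opn[OF W] sub[OF W] in \<open>auto intro: bres_closed\<close>)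
      then show "a = b"
        using reg.separated[of ?\<V> a b, unfolded cover] opn a b by (simp add: regular_act_def)
    qed
    show "(\<lambda>a. act F V a ?e) ` carrier (bsec \<O> V) = sec F V"
    proof
      show "(\<lambda>a. act F V a ?e) ` carrier (bsec \<O> V) \<subseteq> sec F V"
        using V eV by (auto simp: act_closed)
      show "sec F V \<subseteq> (\<lambda>a. act F V a ?e) ` carrier (bsec \<O> V)"
      proof
        fix t assume t: "t \<in> sec F V"
        have "\<exists>a. a \<in> carrier (bsec \<O> W) \<and> act F W a (res F V W ?e) = res F V W t"
          if W: "W \<in> ?\<V>" for W
        proof -
          have "res F V W t \<in> sec F W" using t V opn[OF W] sub[OF W] by (simp add: res_closed)
          from generator_spans[OF genV[OF W] opn[OF W] this] show ?thesis by metis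
        qed
        then obtain \<sigma> where \<sigma>: "\<And>W. W \<in> ?\<V> \<Longrightarrow> \<sigma> W \<in> carrier (bsec \<O> W)"
          "\<And>W. W \<in> ?\<V> \<Longrightarrow> act F W (\<sigma> W) (res F V W ?e) = res F V W t"
          by metis
        \<comment> \<open>Stated over any smaller open set, so that on an overlap both local
          coefficients solve the same equation.\<close>
        have act_\<sigma>: "act F Z (bres \<O> W Z (\<sigma> W)) (res F V Z ?e) = res F V Z t"
          if W: "W \<in> ?\<V>" and Z: "openin X Z" "Z \<subseteq> W" for W Z
        proof -
          have "res F W Z (act F W (\<sigma> W) (res F V W ?e)) =
            act F Z (bres \<O> W Z (\<sigma> W)) (res F W Z (res F V W ?e))"
            using W Z \<sigma> V eV by (intro res_act) (auto simp: opn res_closed)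
          moreover have "res F W Z (res F V W ?e) = res F V Z ?e"
            using W Z V eV opn[OF W] sub[OF W] by (intro res_res) auto
          moreover have "res F W Z (res F V W t) = res F V Z t"
            using W Z V t opn[OF W] sub[OF W] by (intro res_res) auto
          ultimately show ?thesis using \<sigma>(2)[OF W] by simp
        qed
        have "\<exists>!a. a \<in> sec (regular_act \<O>) (\<Union>?\<V>) \<and>
          (\<forall>W\<in>?\<V>. res (regular_act \<O>) (\<Union>?\<V>) W a = \<sigma> W)"
        proof (rule reg.gluing)
          fix W W' assume W: "W \<in> ?\<V>" "W' \<in> ?\<V>"
          have WW': "openin X (W \<inter> W')" using W opn by (blast intro: openin_Int)
          have "generator X \<O> F (W \<inter> W') (res F W (W \<inter> W') (res F V W ?e))"
            using W WW' opn by (intro generator_restrict[OF genV]) auto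
          moreover have "res F W (W \<inter> W') (res F V W ?e) = res F V (W \<inter> W') ?e"
            using W WW' V eV opn sub by (intro res_res) auto
          ultimately have "generator X \<O> F (W \<inter> W') (res F V (W \<inter> W') ?e)" by simp
          then have "bres \<O> W (W \<inter> W') (\<sigma> W) = bres \<O> W' (W \<inter> W') (\<sigma> W')"
          proof (rule generator_cancel[OF _ WW'])
            show "act F (W \<inter> W') (bres \<O> W (W \<inter> W') (\<sigma> W)) (res F V (W \<inter> W') ?e) =
              act F (W \<inter> W') (bres \<O> W' (W \<inter> W') (\<sigma> W')) (res F V (W \<inter> W') ?e)"
              using act_\<sigma>[OF W(1) WW'] act_\<sigma>[OF W(2) WW'] by simp
          qed (use W WW' opn \<sigma>(1) in \<open>auto simp del: image_iff intro!: bres_closed\<close>)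
          then show "res (regular_act \<O>) W (W \<inter> W') (\<sigma> W) = res (regular_act \<O>) W' (W \<inter> W') (\<sigma> W')"
            by (simp add: regular_act_def)
        qed (use opn \<sigma> in \<open>auto simp: regular_act_def\<close>)
        then obtain a where a: "a \<in> carrier (bsec \<O> V)" "\<And>W. W \<in> ?\<V> \<Longrightarrow> bres \<O> V W a = \<sigma> W"
          unfolding cover by (auto simp: regular_act_def)
        have "act F V a ?e = t"
        proof (rule separated[of ?\<V>, unfolded cover])
          fix W assume W: "W \<in> ?\<V>"
          show "res F V W (act F V a ?e) = res F V W t"
            using a \<sigma>(2)[OF W] V eV opn[OF W] sub[OF W] W by (simp add: res_act)
        qed (use opn a eV t V in \<open>auto simp: act_closed\<close>)
        then show "t \<in> (\<lambda>a. act F V a ?e) ` carrier (bsec \<O> V)" using a by blast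
      qed
    qed
  qed
qed

text \<open>The family is a set of pairs because the same open set may arise from several elements
  of the binoid. Compatibility in the case \<open>W = W'\<close> makes all generators over one open
  set equal, so the choice made by \<open>\<sigma>\<close> does not matter.\<close>

lemma glue_generators:
  assumes gen: "\<And>W e. (W, e) \<in> \<G> \<Longrightarrow> openin X W \<and> generator X \<O> F W e"
    and compat: "\<And>W e W' e'. (W, e) \<in> \<G> \<Longrightarrow> (W', e') \<in> \<G> \<Longrightarrow>
      res F W (W \<inter> W') e = res F W' (W \<inter> W') e'"
    and cover: "\<Union>(fst ` \<G>) = V"
  obtains e where "generator X \<O> F V e"
proof -
  let ?\<W> = "fst ` \<G>"
  have "\<forall>W\<in>?\<W>. \<exists>e. (W, e) \<in> \<G>" by auto
  then obtain \<sigma> where \<sigma>: "\<And>W. W \<in> ?\<W> \<Longrightarrow> (W, \<sigma> W) \<in> \<G>" by metis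
  have opn: "openin X W" and \<sigma>_gen: "generator X \<O> F W (\<sigma> W)" if "W \<in> ?\<W>" for W
    using gen[OF \<sigma>[OF that]] by auto
  have "\<exists>!e. e \<in> sec F (\<Union>?\<W>) \<and> (\<forall>W\<in>?\<W>. res F (\<Union>?\<W>) W e = \<sigma> W)"
    by (rule gluing[OF opn generator_in_sec[OF \<sigma>_gen] compat[OF \<sigma> \<sigma>]])
  then obtain e where e: "e \<in> sec F (\<Union>?\<W>)" "\<And>W. W \<in> ?\<W> \<Longrightarrow> res F (\<Union>?\<W>) W e = \<sigma> W"
    by blast
  have "generator X \<O> F (\<Union>?\<W>) e"
    by (rule generator_local[OF opn e(1)]) (simp_all only: e(2) \<sigma>_gen)
  then show ?thesis using that cover by simp
qed

end

section \<open>Sheaves with a global generator\<close>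

locale generated_sheaf = act_sheaf X \<O> F
  for X :: "'p topology" and \<O> :: "('p, 'm) binoid_presheaf" and F :: "('p, 'm, 's) act_presheaf" +
  fixes e
  assumes gen: "generator X \<O> F (topspace X) e"
begin

definition coord :: "'p set \<Rightarrow> 's \<Rightarrow> 'm" where
  "coord V = inv_into (carrier (bsec \<O> V)) (\<lambda>a. act F V a (res F (topspace X) V e))"

lemma e_bij:
  "openin X V \<Longrightarrow>
     bij_betw (\<lambda>a. act F V a (res F (topspace X) V e)) (carrier (bsec \<O> V)) (sec F V)"
  by (simp add: generator_bij[OF gen] openin_subset)

lemma e_res: "openin X V \<Longrightarrow> res F (topspace X) V e \<in> sec F V"
  by (simp add: res_closed openin_subset generator_in_sec[OF gen])

lemma coord_bij: "openin X V \<Longrightarrow> bij_betw (coord V) (sec F V) (carrier (bsec \<O> V))"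
  unfolding coord_def by (rule bij_betw_inv_into[OF e_bij])

lemma coord_closed: "openin X V \<Longrightarrow> s \<in> sec F V \<Longrightarrow> coord V s \<in> carrier (bsec \<O> V)"
  using coord_bij by (meson bij_betwE)

lemma act_coord: "openin X V \<Longrightarrow> s \<in> sec F V \<Longrightarrow> act F V (coord V s) (res F (topspace X) V e) = s"
  unfolding coord_def using bij_betw_inv_into_right[OF e_bij] by simp

lemma coord_unique:
  "openin X V \<Longrightarrow> a \<in> carrier (bsec \<O> V) \<Longrightarrow> act F V a (res F (topspace X) V e) = s \<Longrightarrow> coord V s = a"
  unfolding coord_def using bij_betw_inv_into_left[OF e_bij] by blast

lemma coord_act:
  assumes "openin X V" "a \<in> carrier (bsec \<O> V)" "s \<in> sec F V"
  shows "coord V (act F V a s) = a \<otimes>\<^bsub>bsec \<O> V\<^esub> coord V s"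
  using assms
  by (intro coord_unique) (simp_all add: act_mult e_res coord_closed act_coord monoid_bsec monoid.m_closed)

lemma coord_pt:
  assumes "openin X V" shows "coord V (pt F V) = absorb (bsec \<O> V)"
  using assms
  by (intro coord_unique) (simp_all add: act_absorb e_res binoid.absorb_closed[OF binoid_bsec])

lemma coord_res:
  assumes "openin X V" "openin X W" "W \<subseteq> V" "s \<in> sec F V"
  shows "coord W (res F V W s) = bres \<O> V W (coord V s)"
proof (rule coord_unique)
  have "res F V W (act F V (coord V s) (res F (topspace X) V e)) =
    act F W (bres \<O> V W (coord V s)) (res F (topspace X) W e)"
    using assms
    by (simp add: res_act coord_closed e_res res_res openin_subset generator_in_sec[OF gen])
  then show "act F W (bres \<O> V W (coord V s)) (res F (topspace X) W e) = res F V W s"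
    using assms by (simp add: act_coord)
qed (use assms in \<open>simp_all add: bres_closed coord_closed\<close>)

lemma act_coord_res:
  assumes "openin X V" "openin X W" "W \<subseteq> V" "s \<in> sec F V" "t \<in> sec F V"
  shows "act F W (coord W (res F V W s)) (res F V W t) = res F V W (act F V (coord V s) t)"
  using assms by (simp add: res_act coord_res coord_closed)

text \<open>Every pair \<open>(a e, b e)\<close> is identified with \<open>(e, a b e)\<close>.\<close>

lemma act_smash_rel_eq:
  assumes V: "openin X V"
  shows "act_smash_rel \<O> F F V =
    {((s, t), (s', t')). s \<in> sec F V \<and> t \<in> sec F V \<and> s' \<in> sec F V \<and> t' \<in> sec F V \<and>
       act F V (coord V s) t = act F V (coord V s') t'}" (is "_ = ?R")
proof
  interpret comm_monoid "bsec \<O> V" using V by (rule comm_monoid_bsec)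
  \<comment> \<open>The coefficients of both factors end up multiplied, so it does not matter on
    which factor \<open>a\<close> acts. Hence \<open>act F V (coord V s) t\<close> is invariant
    under the generating identifications.\<close>
  have swap: "act F V (coord V (act F V a s)) t = act F V (coord V s) (act F V a t)"
    if "a \<in> carrier (bsec \<O> V)" "s \<in> sec F V" "t \<in> sec F V" for a s t
    using that V m_comm[of a "coord V s"] by (simp add: coord_act coord_closed flip: act_mult)
  have pt: "act F V (coord V s) t = pt F V"
    if "s \<in> sec F V" "t \<in> sec F V" "s = pt F V \<or> t = pt F V" for s t
    using that V by (auto simp: coord_pt act_absorb act_pt coord_closed)
  have gen_R: "act_smash_gen \<O> F F V \<subseteq> ?R"
    using V unfolding act_smash_gen_def by (auto simp: swap pt act_closed)
  have "y \<in> sec F V \<times> sec F V \<longrightarrow> (x, y) \<in> ?R"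
    if "(x, y) \<in> (act_smash_gen \<O> F F V \<union> (act_smash_gen \<O> F F V)\<inverse>)\<^sup>*" "x \<in> sec F V \<times> sec F V" for x y
    using that
  proof (induction rule: rtrancl_induct)
    case (step y z)
    then have "(y, z) \<in> ?R" using gen_R by auto
    with step show ?case by auto
  qed auto
  then show "act_smash_rel \<O> F F V \<subseteq> ?R" unfolding act_smash_rel_def by blast
  let ?e = "res F (topspace X) V e"
  let ?S = "(act_smash_gen \<O> F F V \<union> (act_smash_gen \<O> F F V)\<inverse>)\<^sup>*"
  \<comment> \<open>Since \<open>s\<close> is its coefficient acting on the generator, a single
    identification moves this coefficient to the other factor; pairs with equal products then meet
    in the same pair.\<close>
  have normal: "((s, t), (?e, act F V (coord V s) t)) \<in> act_smash_gen \<O> F F V"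
    if "s \<in> sec F V" "t \<in> sec F V" for s t
  proof -
    have "((act F V (coord V s) ?e, t), (?e, act F V (coord V s) t)) \<in> act_smash_gen \<O> F F V"
      unfolding act_smash_gen_def using that V by (blast intro: coord_closed e_res)
    then show ?thesis using that V by (simp add: act_coord)
  qed
  show "?R \<subseteq> act_smash_rel \<O> F F V"
  proof
    fix z assume "z \<in> ?R"
    then obtain s t s' t' where z: "z = ((s, t), (s', t'))"
      and s: "s \<in> sec F V" "t \<in> sec F V" "s' \<in> sec F V" "t' \<in> sec F V"
      and eq: "act F V (coord V s) t = act F V (coord V s') t'" by blast
    have "((s, t), (?e, act F V (coord V s) t)) \<in> ?S" using normal[OF s(1,2)] by blast
    moreover have "((?e, act F V (coord V s) t), (s', t')) \<in> ?S"
      unfolding eq using normal[OF s(3,4)] by blast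
    ultimately have "((s, t), (s', t')) \<in> ?S" by (rule rtrancl_trans)
    with z s show "z \<in> act_smash_rel \<O> F F V" unfolding act_smash_rel_def by simp
  qed
qed

text \<open>Sending \<open>(a e, b e)\<close> to \<open>a b e\<close> is bijective over every open
  set even before sheafification. In both local conditions the neighbourhood can therefore be the
  whole open set.\<close>

lemma smash_self_sheafification: "is_sheafification X \<O> (act_smash \<O> F F) F"
proof -
  let ?r = "act_smash_rel \<O> F F"
  let ?c = "\<lambda>V p. ?r V `` {p}"
  define \<psi> where "\<psi> V p = act F V (coord V (fst p)) (snd p)" for V p
  \<comment> \<open>Any representative gives the same value, as a class is exactly a fibre of
    \<open>\<psi>\<close>.\<close>
  define \<theta> where "\<theta> V Y = \<psi> V (SOME p. p \<in> Y)" for V Y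
  have class_iff: "p' \<in> ?c V p \<longleftrightarrow> p' \<in> sec F V \<times> sec F V \<and> \<psi> V p = \<psi> V p'"
    if "openin X V" "p \<in> sec F V \<times> sec F V" for V p p'
    using that by (auto simp: act_smash_rel_eq \<psi>_def)
  have class_eq: "?c V p = ?c V p' \<longleftrightarrow> \<psi> V p = \<psi> V p'"
    if "openin X V" "p \<in> sec F V \<times> sec F V" "p' \<in> sec F V \<times> sec F V" for V p p'
    using that class_iff by (metis (no_types, lifting) subsetI subset_antisym)
  have \<theta>_class: "\<theta> V (?c V p) = \<psi> V p" if "openin X V" "p \<in> sec F V \<times> sec F V" for V p
  proof -
    have "(SOME p'. p' \<in> ?c V p) \<in> ?c V p" using class_iff[OF that] that by (metis someI)
    then show ?thesis unfolding \<theta>_def class_iff[OF that] by simp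
  qed
  \<comment> \<open>The operations on the quotient are unions over all representatives; such a union
    collapses to one class when \<open>g\<close> respects the fibres of
    \<open>\<psi>\<close>.\<close>
  have UN_class: "(\<Union>x\<in>?c V p. ?c W (g x)) = ?c W (g p)"
    if V: "openin X V" and W: "openin X W" and p: "p \<in> sec F V \<times> sec F V"
      and g: "\<And>x. x \<in> sec F V \<times> sec F V \<Longrightarrow> g x \<in> sec F W \<times> sec F W"
      and \<psi>: "\<And>x. x \<in> sec F V \<times> sec F V \<Longrightarrow> \<psi> V x = \<psi> V p \<Longrightarrow> \<psi> W (g x) = \<psi> W (g p)" for V W p g
  proof -
    have "?c W (g x) = ?c W (g p)" if x: "x \<in> ?c V p" for x
    proof -
      have "x \<in> sec F V \<times> sec F V" "\<psi> V x = \<psi> V p"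
        using x class_iff[OF V p] by auto
      then show ?thesis using class_eq[OF W] g[OF p] g \<psi> by simp
    qed
    moreover have "p \<in> ?c V p" unfolding class_iff[OF V p] using p by blast
    ultimately show ?thesis by blast
  qed
  have secE: "\<exists>p. p \<in> sec F V \<times> sec F V \<and> Y = ?c V p" if "Y \<in> sec (act_smash \<O> F F) V" for V Y
    using that by (auto simp: act_smash_def elim!: quotientE)
  have \<psi>_closed: "\<psi> V p \<in> sec F V" if "openin X V" "p \<in> sec F V \<times> sec F V" for V p
    using that by (auto simp: \<psi>_def act_closed coord_closed)
  have res_class: "res (act_smash \<O> F F) V W (?c V p) = ?c W (res F V W (fst p), res F V W (snd p))"
    if "openin X V" "openin X W" "W \<subseteq> V" "p \<in> sec F V \<times> sec F V" for V W p
    unfolding act_smash_def act_presheaf.simps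
    by (rule UN_class) (use that in \<open>auto simp: \<psi>_def res_closed act_coord_res\<close>)
  have act_class: "act (act_smash \<O> F F) V a (?c V p) = ?c V (act F V a (fst p), snd p)"
    if "openin X V" "a \<in> carrier (bsec \<O> V)" "p \<in> sec F V \<times> sec F V" for V a p
    unfolding act_smash_def act_presheaf.simps
    by (rule UN_class) (use that in \<open>auto simp: \<psi>_def act_closed coord_act act_mult coord_closed\<close>)
  have \<psi>_act: "\<psi> V (act F V a (fst p), snd p) = act F V a (\<psi> V p)"
    if "openin X V" "a \<in> carrier (bsec \<O> V)" "p \<in> sec F V \<times> sec F V" for V a p
    using that by (auto simp: \<psi>_def coord_act act_mult coord_closed)
  have \<psi>_res: "\<psi> W (res F V W (fst p), res F V W (snd p)) = res F V W (\<psi> V p)"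
    if "openin X V" "openin X W" "W \<subseteq> V" "p \<in> sec F V \<times> sec F V" for V W p
    using that by (auto simp: \<psi>_def act_coord_res)
  have hom: "act_presheaf_hom X \<O> (act_smash \<O> F F) F \<theta>"
    unfolding act_presheaf_hom_def
  proof (intro conjI allI impI ballI)
    fix V assume V: "openin X V"
    show "\<theta> V \<in> sec (act_smash \<O> F F) V \<rightarrow> sec F V"
    proof
      fix Y assume "Y \<in> sec (act_smash \<O> F F) V"
      then obtain p where "p \<in> sec F V \<times> sec F V" "Y = ?c V p" using secE by blast
      then show "\<theta> V Y \<in> sec F V" using V \<theta>_class \<psi>_closed by simp
    qed
    have "\<theta> V (?c V (pt F V, pt F V)) = pt F V"
      using V by (subst \<theta>_class) (auto simp: \<psi>_def pt_closed act_pt coord_closed)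
    then show "\<theta> V (pt (act_smash \<O> F F) V) = pt F V" by (simp add: act_smash_def)
    fix a Y assume a: "a \<in> carrier (bsec \<O> V)" and "Y \<in> sec (act_smash \<O> F F) V"
    then obtain p where p: "p \<in> sec F V \<times> sec F V" "Y = ?c V p" using secE by blast
    then have "(act F V a (fst p), snd p) \<in> sec F V \<times> sec F V"
      using V a by (auto simp: act_closed)
    then show "\<theta> V (act (act_smash \<O> F F) V a Y) = act F V a (\<theta> V Y)"
      using V a p by (simp add: act_class \<theta>_class \<psi>_act del: Image_singleton_iff)
  next
    fix V W Y assume VW: "openin X V \<and> openin X W \<and> W \<subseteq> V" and "Y \<in> sec (act_smash \<O> F F) V"
    then obtain p where p: "p \<in> sec F V \<times> sec F V" "Y = ?c V p" using secE by blast
    then have "(res F V W (fst p), res F V W (snd p)) \<in> sec F W \<times> sec F W"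
      using VW by (auto simp: res_closed)
    then show "\<theta> W (res (act_smash \<O> F F) V W Y) = res F V W (\<theta> V Y)"
      using VW p by (simp add: res_class \<theta>_class \<psi>_res)
  qed
  have inj: "Y = Y'"
    if V: "openin X V" and Y: "Y \<in> sec (act_smash \<O> F F) V" and Y': "Y' \<in> sec (act_smash \<O> F F) V"
      and eq: "\<theta> V Y = \<theta> V Y'"
    for V Y Y'
  proof -
    obtain p where p: "p \<in> sec F V \<times> sec F V" "Y = ?c V p" using secE[OF Y] by blast
    obtain p' where p': "p' \<in> sec F V \<times> sec F V" "Y' = ?c V p'" using secE[OF Y'] by blast
    have "\<psi> V p = \<psi> V p'"
      using eq unfolding p(2) p'(2) \<theta>_class[OF V p(1)] \<theta>_class[OF V p'(1)] .
    then show ?thesis unfolding p(2) p'(2) class_eq[OF V p(1) p'(1)] .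
  qed
  have surj: "\<exists>Y\<in>sec (act_smash \<O> F F) V. \<theta> V Y = t" if V: "openin X V" and t: "t \<in> sec F V" for V t
  proof -
    \<comment> \<open>With the generator as second factor, the product is the coefficient of
      \<open>t\<close> acting on the generator, that is, \<open>t\<close>.\<close>
    let ?p = "(t, res F (topspace X) V e)"
    have p: "?p \<in> sec F V \<times> sec F V" using V t e_res by simp
    then have "?c V ?p \<in> sec (act_smash \<O> F F) V"
      by (simp add: act_smash_def quotientI)
    moreover have "\<theta> V (?c V ?p) = t" using V t p by (simp add: \<theta>_class \<psi>_def act_coord)
    ultimately show ?thesis by blast
  qed
  show ?thesis
    unfolding is_sheafification_def
  proof (intro conjI exI allI impI ballI)
    show "act_presheaf_hom X \<O> (act_smash \<O> F F) F \<theta>" by (rule hom)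
    fix V Y Y' q
    assume "openin X V \<and> Y \<in> sec (act_smash \<O> F F) V \<and> Y' \<in> sec (act_smash \<O> F F) V \<and>
      \<theta> V Y = \<theta> V Y'" "q \<in> V"
    then have "Y = Y'" "openin X V" "q \<in> V" using inj by blast+
    then show "openin X V" "q \<in> V" "V \<subseteq> V"
      "res (act_smash \<O> F F) V V Y = res (act_smash \<O> F F) V V Y'" by auto
  next
    fix V t q assume V: "openin X V \<and> t \<in> sec F V" "q \<in> V"
    then show "openin X V" "q \<in> V" "V \<subseteq> V" by auto
    show "\<exists>Y\<in>sec (act_smash \<O> F F) V. \<theta> V Y = res F V V t"
      using V surj by (simp add: res_self)
  qed (rule sheaf)
qed

end

section \<open>From global generators to a trivial Picard group\<close>

context binoid_sheaf
begin

text \<open>The isomorphism keeps coefficients: \<open>a\<close> acting on \<open>e\<close> goes to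
  \<open>a\<close> acting on \<open>e'\<close>.\<close>

lemma isomorphic_of_generators:
  assumes "generated_sheaf X \<O> F e" "generated_sheaf X \<O> G e'"
  shows "act_presheaf_isomorphic X \<O> F G"
proof -
  interpret F: generated_sheaf X \<O> F e by (rule assms(1))
  interpret G: generated_sheaf X \<O> G e' by (rule assms(2))
  define \<theta> where "\<theta> V s = act G V (F.coord V s) (res G (topspace X) V e')" for V s
  have \<theta>_closed: "\<theta> V s \<in> sec G V" if "openin X V" "s \<in> sec F V" for V s
    using that by (simp add: \<theta>_def G.act_closed F.coord_closed G.e_res)
  have "act_presheaf_hom X \<O> F G \<theta>"
    unfolding act_presheaf_hom_def
  proof (intro conjI allI impI ballI)
    fix V assume V: "openin X V"
    show "\<theta> V \<in> sec F V \<rightarrow> sec G V" using V \<theta>_closed by blast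
    show "\<theta> V (pt F V) = pt G V" using V by (simp add: \<theta>_def F.coord_pt G.act_absorb G.e_res)
    fix a s assume "a \<in> carrier (bsec \<O> V)" "s \<in> sec F V"
    then show "\<theta> V (act F V a s) = act G V a (\<theta> V s)"
      using V by (simp add: \<theta>_def F.coord_act G.act_mult G.e_res F.coord_closed)
  next
    fix V W s assume "openin X V \<and> openin X W \<and> W \<subseteq> V" "s \<in> sec F V"
    then show "\<theta> W (res F V W s) = res G V W (\<theta> V s)"
      by (simp add: \<theta>_def F.coord_res G.res_act F.coord_closed G.e_res G.res_res openin_subset
          G.generator_in_sec[OF G.gen])
  qed
  moreover have "bij_betw (\<theta> V) (sec F V) (sec G V)" if "openin X V" for V
    using bij_betw_trans[OF F.coord_bij[OF that] G.e_bij[OF that]] by (simp add: \<theta>_def[abs_def] o_def)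
  ultimately show ?thesis unfolding act_presheaf_isomorphic_def by blast
qed

lemma generated_sheaf_regular: "generated_sheaf X \<O> (regular_act \<O>) \<one>\<^bsub>bsec \<O> (topspace X)\<^esub>"
proof unfold_locales
  show "generator X \<O> (regular_act \<O>) (topspace X) \<one>\<^bsub>bsec \<O> (topspace X)\<^esub>"
    unfolding generator_def
  proof (intro conjI allI impI)
    show "\<one>\<^bsub>bsec \<O> (topspace X)\<^esub> \<in> sec (regular_act \<O>) (topspace X)"
      by (simp add: regular_act_def one_bsec_closed)
    fix V assume V: "openin X V \<and> V \<subseteq> topspace X"
    then interpret V: comm_monoid "bsec \<O> V" using comm_monoid_bsec by blast
    have "bij_betw id (carrier (bsec \<O> V)) (sec (regular_act \<O>) V)" by (simp add: regular_act_def)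
    then show "bij_betw (\<lambda>a. act (regular_act \<O>) V a (res (regular_act \<O>) (topspace X) V \<one>\<^bsub>bsec \<O> (topspace X)\<^esub>))
        (carrier (bsec \<O> V)) (sec (regular_act \<O>) V)"
      by (rule bij_betw_cong[THEN iffD1, rotated]) (use V in \<open>simp add: regular_act_def bres_one\<close>)
  qed
qed

text \<open>A copy of \<open>\<O>\<close> whose sections have the sum type used in
  \<open>Pic\<close>. It guarantees that there is an invertible sheaf of that type, so that the
  quotient forming the carrier has a class.\<close>

definition inl_regular :: "('p, 'm, 'm + 'c) act_presheaf" where
  "inl_regular =
     \<lparr>sec = (\<lambda>V. Inl ` carrier (bsec \<O> V)), res = (\<lambda>V W s. Inl (bres \<O> V W (projl s))),
      act = (\<lambda>V a s. Inl (a \<otimes>\<^bsub>bsec \<O> V\<^esub> projl s)), pt = (\<lambda>V. Inl (absorb (bsec \<O> V)))\<rparr>"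

lemma sheaf_inl_regular: "sheaf_of_act_sets X \<O> inl_regular"
  unfolding sheaf_of_act_sets_def
proof (intro conjI allI impI ballI)
  show "presheaf_of_sets X inl_regular"
    unfolding presheaf_of_sets_def inl_regular_def
    by (auto simp: bres_closed bres_self bres_bres)
  show "gluing_axiom X inl_regular"
    unfolding gluing_axiom_def
  proof (intro allI impI, elim conjE)
    fix \<W> and \<sigma> :: "'p set \<Rightarrow> 'm + 'd"
    assume \<W>: "\<forall>W\<in>\<W>. openin X W \<and> \<sigma> W \<in> sec inl_regular W"
      and compat: "\<forall>W\<in>\<W>. \<forall>W'\<in>\<W>. res inl_regular W (W \<inter> W') (\<sigma> W) = res inl_regular W' (W \<inter> W') (\<sigma> W')"
    have "\<exists>!s. s \<in> sec (regular_act \<O>) (\<Union>\<W>) \<and>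
      (\<forall>W\<in>\<W>. res (regular_act \<O>) (\<Union>\<W>) W s = projl (\<sigma> W))"
      by (rule reg.gluing) (use \<W> compat in \<open>auto simp: regular_act_def inl_regular_def\<close>)
    then obtain s where s: "s \<in> carrier (bsec \<O> (\<Union>\<W>))" "\<forall>W\<in>\<W>. bres \<O> (\<Union>\<W>) W s = projl (\<sigma> W)"
      and uniq: "\<And>s'. s' \<in> carrier (bsec \<O> (\<Union>\<W>)) \<Longrightarrow>
        \<forall>W\<in>\<W>. bres \<O> (\<Union>\<W>) W s' = projl (\<sigma> W) \<Longrightarrow> s' = s"
      unfolding regular_act_def by auto
    have inl: "Inl (projl (\<sigma> W)) = \<sigma> W" if "W \<in> \<W>" for W
      using \<W> that by (auto simp: inl_regular_def)
    show "\<exists>!s. s \<in> sec inl_regular (\<Union>\<W>) \<and> (\<forall>W\<in>\<W>. res inl_regular (\<Union>\<W>) W s = \<sigma> W)"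
    proof (rule ex1I)
      show "Inl s \<in> sec inl_regular (\<Union>\<W>) \<and> (\<forall>W\<in>\<W>. res inl_regular (\<Union>\<W>) W (Inl s) = \<sigma> W)"
        using s inl by (simp add: inl_regular_def)
      fix s' assume s': "s' \<in> sec inl_regular (\<Union>\<W>) \<and> (\<forall>W\<in>\<W>. res inl_regular (\<Union>\<W>) W s' = \<sigma> W)"
      then obtain t where t: "s' = Inl t" "t \<in> carrier (bsec \<O> (\<Union>\<W>))"
        by (auto simp: inl_regular_def)
      have "bres \<O> (\<Union>\<W>) W t = projl (\<sigma> W)" if "W \<in> \<W>" for W
        using s' t that by (metis (no_types, lifting) act_presheaf.simps(2) inl_regular_def sum.sel(1))
      then show "s' = Inl s" using uniq t by blast
    qed
  qed
next
  fix V assume V: "openin X V"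
  then interpret V: binoid "bsec \<O> V" by (rule binoid_bsec)
  show "binoid_act (bsec \<O> V) (sec inl_regular V) (act inl_regular V) (pt inl_regular V)"
    unfolding binoid_act_def inl_regular_def
    by (auto simp: V.absorb_closed V.absorb_mult V.m_assoc V.m_comm[of _ "absorb (bsec \<O> V)"])
next
  fix V W assume VW: "openin X V \<and> openin X W \<and> W \<subseteq> V"
  then show "res inl_regular V W (pt inl_regular V) = pt inl_regular W"
    by (simp add: inl_regular_def bres_absorb)
  fix a s assume "a \<in> carrier (bsec \<O> V)" "s \<in> sec inl_regular V"
  then show "res inl_regular V W (act inl_regular V a s) =
      act inl_regular W (bres \<O> V W a) (res inl_regular V W s)"
    using VW by (auto simp: inl_regular_def bres_mult)
qed

lemma invertible_inl_regular: "invertible_sheaf X \<O> inl_regular"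
proof -
  have "act_presheaf_isomorphic X \<O> inl_regular (regular_act \<O>)"
    unfolding act_presheaf_isomorphic_def act_presheaf_hom_def inl_regular_def regular_act_def
    by (rule exI[of _ "\<lambda>V. projl"]) (auto simp: bij_betw_def inj_on_def image_image)
  then have "\<exists>V. openin X V \<and> p \<in> V \<and>
      act_presheaf_isomorphic (subtopology X V) \<O> inl_regular (regular_act \<O>)"
    if "p \<in> topspace X" for p
    using that by (intro exI[of _ "topspace X"]) simp
  then show ?thesis unfolding invertible_sheaf_def using sheaf_inl_regular by blast
qed

text \<open>All invertible sheaves form one class \<open>?A\<close>. Its product with itself
  consists of invertible sheaves by definition, and it contains each \<open>L\<close> because
  \<open>L\<close> is a sheafification of its own smash square.\<close>

theorem trivial_Pic:
  assumes "\<And>L :: ('p, 'm, 'm + 'c) act_presheaf. invertible_sheaf X \<O> L \<Longrightarrow>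
    \<exists>e. generator X \<O> L (topspace X) e"
  shows "trivial_group (Pic TYPE('c) X \<O>)"
proof -
  let ?A = "{L :: ('p, 'm, 'm + 'c) act_presheaf. invertible_sheaf X \<O> L}"
  have generated: "\<exists>e. generated_sheaf X \<O> L e" if "L \<in> ?A" for L
  proof -
    obtain e where "generator X \<O> L (topspace X) e" using assms \<open>L \<in> ?A\<close> by blast
    then show ?thesis
      using that unfolding invertible_sheaf_def by (intro exI[of _ e]) (unfold_locales, auto)
  qed
  have regular: "act_presheaf_isomorphic X \<O> L (regular_act \<O>)" if "L \<in> ?A" for L
    using generated[OF that] generated_sheaf_regular by (elim exE) (rule isomorphic_of_generators)
  have one: "\<one>\<^bsub>Pic TYPE('c) X \<O>\<^esub> = ?A"
    using regular by (auto simp: Pic_def)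
  have "act_presheaf_isomorphic X \<O> L L'" if "L \<in> ?A" "L' \<in> ?A" for L L'
    using generated[OF that(1)] generated[OF that(2)] by (elim exE) (rule isomorphic_of_generators)
  then have "{(L, L'). invertible_sheaf X \<O> L \<and> invertible_sheaf X \<O> L' \<and>
      act_presheaf_isomorphic X \<O> L L'} = ?A \<times> ?A"
    by auto
  moreover have "?A \<noteq> {}" using invertible_inl_regular by blast
  ultimately have carrier: "carrier (Pic TYPE('c) X \<O>) = {?A}"
    by (auto simp: Pic_def quotient_def)
  have smash: "is_sheafification X \<O> (act_smash \<O> L L) L" if "L \<in> ?A" for L
    using generated[OF that] by (elim exE) (rule generated_sheaf.smash_self_sheafification)
  have mult: "?A \<otimes>\<^bsub>Pic TYPE('c) X \<O>\<^esub> ?A = ?A"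
    using smash by (auto simp: Pic_def)
  have "group (Pic TYPE('c) X \<O>)"
    by (rule groupI) (simp_all only: carrier one mult singleton_iff, simp_all add: mult)
  then show ?thesis by (simp add: trivial_group_def carrier one)
qed

end

section \<open>Localization and the structure sheaf\<close>

locale integral_cancellative_binoid = binoid M for M :: "('a, 'z) binoid_scheme" (structure) +
  assumes integral: "integral_binoid M" and cancellative: "cancellative M"
begin

lemma submonoid_nonabsorb: "submonoid (nonabsorb M) M"
  using integral by (simp add: integral_binoid_def)

lemma one_nonabsorb: "\<one> \<in> nonabsorb M"
  using submonoid_nonabsorb by (rule submonoid.one_closed)

lemma nonabsorb_mult: "a \<in> nonabsorb M \<Longrightarrow> b \<in> nonabsorb M \<Longrightarrow> a \<otimes> b \<in> nonabsorb M"
  using submonoid_nonabsorb by (rule submonoid.m_closed)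

lemma nonabsorb_carrier: "a \<in> nonabsorb M \<Longrightarrow> a \<in> carrier M"
  by (simp add: nonabsorb_def)

lemma nonabsorb_pow: "a \<in> nonabsorb M \<Longrightarrow> a [^] (n::nat) \<in> nonabsorb M"
  by (induction n) (simp_all add: one_nonabsorb nonabsorb_mult)

lemma mult_absorb: "a \<in> carrier M \<Longrightarrow> a \<otimes> absorb M = absorb M"
  using absorb_mult m_comm absorb_closed by metis

lemma nonabsorb_factor:
  assumes "a \<otimes> b \<in> nonabsorb M" "a \<in> carrier M" "b \<in> carrier M"
  shows "a \<in> nonabsorb M" "b \<in> nonabsorb M"
  using assms by (auto simp: nonabsorb_def absorb_mult mult_absorb)

text \<open>The cancellation axiom only covers products other than \<open>absorb M\<close>. If the
  product is absorbing, integrality forces both \<open>a\<close> and \<open>b\<close> to be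
  absorbing.\<close>

lemma nonabsorb_cancel:
  assumes "c \<in> nonabsorb M" "a \<in> carrier M" "b \<in> carrier M" "c \<otimes> a = c \<otimes> b"
  shows "a = b"
proof (cases "c \<otimes> b = absorb M")
  case True
  then have "a \<notin> nonabsorb M" "b \<notin> nonabsorb M"
    using assms nonabsorb_mult[of c] unfolding nonabsorb_def by force+
  then show ?thesis using assms by (simp add: nonabsorb_def)
next
  case False
  then show ?thesis
    using cancellative assms nonabsorb_carrier unfolding cancellative_def by blast
qed

context
  fixes S assumes S: "submonoid S M" "S \<subseteq> nonabsorb M"
begin

lemma S_carrier: "s \<in> S \<Longrightarrow> s \<in> carrier M"
  using S(2) by (auto simp: nonabsorb_def)

lemma S_mult: "s \<in> S \<Longrightarrow> t \<in> S \<Longrightarrow> s \<otimes> t \<in> S"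
  using S(1) by (rule submonoid.m_closed)

lemma S_one: "\<one> \<in> S"
  using S(1) by (rule submonoid.one_closed)

lemma S_cancel: "s \<in> S \<Longrightarrow> a \<in> carrier M \<Longrightarrow> b \<in> carrier M \<Longrightarrow> s \<otimes> a = s \<otimes> b \<longleftrightarrow> a = b"
  using S(2) nonabsorb_cancel by blast

text \<open>The auxiliary multiplier in \<open>loc_rel\<close> lies in \<open>S\<close>, which
  avoids the absorbing element, so it can be cancelled and equality of fractions is
  cross-multiplication.\<close>

lemma mem_fraction_iff:
  assumes "a \<in> carrier M" "s \<in> S"
  shows "(b, t) \<in> fraction M S a s \<longleftrightarrow> b \<in> carrier M \<and> t \<in> S \<and> a \<otimes> t = b \<otimes> s"
  using assms S_one S_carrier S_cancel unfolding fraction_def loc_rel_def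
  by (auto intro!: bexI[of _ \<one>])

lemma fraction_eq_iff:
  assumes "a \<in> carrier M" "s \<in> S" "b \<in> carrier M" "t \<in> S"
  shows "fraction M S a s = fraction M S b t \<longleftrightarrow> a \<otimes> t = b \<otimes> s"
proof
  assume "fraction M S a s = fraction M S b t"
  moreover have "(b, t) \<in> fraction M S b t" using assms by (simp add: mem_fraction_iff)
  ultimately have "(b, t) \<in> fraction M S a s" by simp
  then show "a \<otimes> t = b \<otimes> s" using assms by (simp add: mem_fraction_iff)
next
  assume eq: "a \<otimes> t = b \<otimes> s"
  have "a \<otimes> r = c \<otimes> s \<longleftrightarrow> b \<otimes> r = c \<otimes> t" if "c \<in> carrier M" "r \<in> S" for c r
  proof -
    have car: "s \<in> carrier M" "t \<in> carrier M" "r \<in> carrier M" using assms that S_carrier by auto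
    have "t \<otimes> (a \<otimes> r) = (a \<otimes> t) \<otimes> r" using assms that car by (simp add: m_ac)
    also have "\<dots> = s \<otimes> (b \<otimes> r)" using assms that car by (simp add: eq m_ac)
    finally have 1: "t \<otimes> (a \<otimes> r) = s \<otimes> (b \<otimes> r)" .
    have 2: "t \<otimes> (c \<otimes> s) = s \<otimes> (c \<otimes> t)" using assms that car by (simp add: m_ac)
    show ?thesis
      using S_cancel[of t "a \<otimes> r" "c \<otimes> s"] S_cancel[of s "b \<otimes> r" "c \<otimes> t"] 1 2 assms that car
      by simp
  qed
  then show "fraction M S a s = fraction M S b t"
    using assms by (auto simp: mem_fraction_iff)
qed

lemma carrier_localization:
  "carrier (localization M S) = {fraction M S a s | a s. a \<in> carrier M \<and> s \<in> S}"
  unfolding localization_def quotient_binoid_def loc_pairs_def quotient_def fraction_def by auto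

lemma mult_fraction:
  assumes "a \<in> carrier M" "s \<in> S" "b \<in> carrier M" "t \<in> S"
  shows "fraction M S a s \<otimes>\<^bsub>localization M S\<^esub> fraction M S b t = fraction M S (a \<otimes> b) (s \<otimes> t)"
proof -
  have eq: "fraction M S (fst x \<otimes> fst y) (snd x \<otimes> snd y) = fraction M S (a \<otimes> b) (s \<otimes> t)"
    if "x \<in> fraction M S a s" "y \<in> fraction M S b t" for x y
  proof -
    obtain a' s' b' t' where xy: "x = (a', s')" "y = (b', t')" by fastforce
    have x: "a' \<in> carrier M" "s' \<in> S" "a \<otimes> s' = a' \<otimes> s"
      and y: "b' \<in> carrier M" "t' \<in> S" "b \<otimes> t' = b' \<otimes> t"
      using that assms unfolding xy by (simp_all add: mem_fraction_iff)
    have car: "s \<in> carrier M" "t \<in> carrier M" "s' \<in> carrier M" "t' \<in> carrier M"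
      using assms x y S_carrier by auto
    have "(a' \<otimes> b') \<otimes> (s \<otimes> t) = (a' \<otimes> s) \<otimes> (b' \<otimes> t)" using assms x(1) y(1) car by (simp add: m_ac)
    also have "\<dots> = (a \<otimes> b) \<otimes> (s' \<otimes> t')"
      unfolding x(3)[symmetric] y(3)[symmetric] using assms car by (simp add: m_ac)
    finally show ?thesis
      using assms x(1,2) y(1,2) by (simp add: xy fraction_eq_iff S_mult)
  qed
  have "(a, s) \<in> fraction M S a s" "(b, t) \<in> fraction M S b t"
    using assms by (simp_all add: mem_fraction_iff)
  then have "(\<Union>x\<in>fraction M S a s. \<Union>y\<in>fraction M S b t. fraction M S (fst x \<otimes> fst y) (snd x \<otimes> snd y)) =
      fraction M S (a \<otimes> b) (s \<otimes> t)"
    using eq by blast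
  then show ?thesis
    by (simp add: localization_def quotient_binoid_def loc_pairs_def fraction_def)
qed

lemma one_localization: "\<one>\<^bsub>localization M S\<^esub> = fraction M S \<one> \<one>"
  by (simp add: localization_def quotient_binoid_def loc_pairs_def fraction_def)

lemma absorb_localization: "absorb (localization M S) = fraction M S (absorb M) \<one>"
  by (simp add: localization_def quotient_binoid_def loc_pairs_def fraction_def)

lemma binoid_localization: "binoid (localization M S)"
proof -
  have "comm_monoid (localization M S)"
    by (rule comm_monoidI)
      (auto simp: carrier_localization mult_fraction one_localization fraction_eq_iff
        S_carrier S_mult S_one m_ac, use S_mult in blast, use S_one in blast)
  moreover have "absorb (localization M S) \<in> carrier (localization M S)"
    using absorb_closed S_one by (auto simp: carrier_localization absorb_localization)
  moreover have "absorb (localization M S) \<otimes>\<^bsub>localization M S\<^esub> x = absorb (localization M S)"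
    if "x \<in> carrier (localization M S)" for x
  proof -
    obtain a s where "x = fraction M S a s" "a \<in> carrier M" "s \<in> S"
      using \<open>x \<in> _\<close> carrier_localization by blast
    then show ?thesis
      using absorb_closed
      by (simp add: absorb_localization mult_fraction fraction_eq_iff absorb_mult S_one S_carrier)
  qed
  ultimately show ?thesis by (simp add: binoid_def binoid_axioms_def)
qed

end

section \<open>Prime ideals and the topology of the spectrum\<close>

lemma prime_ideal_nonabsorb: "prime_ideal M P \<Longrightarrow> carrier M - P \<subseteq> nonabsorb M"
  by (auto simp: prime_ideal_def nonabsorb_def)

lemma prime_ideal_submonoid: "prime_ideal M P \<Longrightarrow> submonoid (carrier M - P) M"
  by (simp add: prime_ideal_def)

lemmas stalk_fraction_eq_iff = fraction_eq_iff[OF prime_ideal_submonoid prime_ideal_nonabsorb]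
lemmas stalk_mult_fraction =
  mult_fraction[OF prime_ideal_submonoid prime_ideal_nonabsorb, folded stalk_def]
lemmas binoid_stalk =
  binoid_localization[OF prime_ideal_submonoid prime_ideal_nonabsorb, folded stalk_def]

lemma prime_ideal_one: "prime_ideal M P \<Longrightarrow> \<one> \<notin> P"
  using submonoid.one_closed by (force simp: prime_ideal_def)

lemma prime_ideal_mult_iff:
  assumes "prime_ideal M P" "a \<in> carrier M" "b \<in> carrier M"
  shows "a \<otimes> b \<in> P \<longleftrightarrow> a \<in> P \<or> b \<in> P"
proof -
  have "a \<otimes> b \<notin> P" if "a \<notin> P" "b \<notin> P"
    using submonoid.m_closed[OF prime_ideal_submonoid[OF assms(1)], of a b] assms that by simp
  moreover have "a \<otimes> b \<in> P" if "a \<in> P" using assms that by (simp add: prime_ideal_def)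
  moreover have "a \<otimes> b \<in> P" if "b \<in> P"
    using assms that m_comm[of a b] by (simp add: prime_ideal_def)
  ultimately show ?thesis by blast
qed

lemma prime_ideal_pow:
  assumes "prime_ideal M P" "a \<in> carrier M" "a [^] (n::nat) \<in> P"
  shows "a \<in> P"
  using assms(3) by (induction n) (use assms(1,2) in \<open>auto simp: prime_ideal_one prime_ideal_mult_iff\<close>)

lemma basic_open_mult:
  "f \<in> carrier M \<Longrightarrow> g \<in> carrier M \<Longrightarrow> basic_open M (f \<otimes> g) = basic_open M f \<inter> basic_open M g"
  by (auto simp: basic_open_def prime_ideal_mult_iff)

lemma basic_open_one: "basic_open M \<one> = {P. prime_ideal M P}"
  by (auto simp: basic_open_def prime_ideal_one)

text \<open>The basic open sets are a basis and not merely a subbasis, because \<open>D f\<close>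
  and \<open>D g\<close> intersect in \<open>D (f \<otimes> g)\<close>.\<close>

lemma openin_Spec_iff:
  "openin (Spec M) V \<longleftrightarrow>
     V \<subseteq> {P. prime_ideal M P} \<and> (\<forall>P\<in>V. \<exists>f\<in>carrier M. P \<in> basic_open M f \<and> basic_open M f \<subseteq> V)"
    (is "_ \<longleftrightarrow> ?Q V")
proof
  assume "openin (Spec M) V"
  then have "generate_topology_on (basic_open M ` carrier M) V"
    by (simp add: Spec_def openin_topology_generated_by_iff)
  then show "?Q V"
  proof induction
    case (Int a b)
    have "\<exists>h\<in>carrier M. P \<in> basic_open M h \<and> basic_open M h \<subseteq> a \<inter> b" if "P \<in> a \<inter> b" for P
    proof -
      obtain f g where "f \<in> carrier M" "P \<in> basic_open M f" "basic_open M f \<subseteq> a"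
        and "g \<in> carrier M" "P \<in> basic_open M g" "basic_open M g \<subseteq> b"
        using Int.IH \<open>P \<in> a \<inter> b\<close> by blast
      then show ?thesis by (intro bexI[of _ "f \<otimes> g"]) (auto simp: basic_open_mult)
    qed
    then show ?case using Int.IH by blast
  next
    case (UN K)
    then show ?case by (metis (no_types, lifting) Sup_le_iff UnionE Union_upper order_trans)
  qed (auto simp: basic_open_def)
next
  assume V: "?Q V"
  have "openin (Spec M) (\<Union>{basic_open M f | f. f \<in> carrier M \<and> basic_open M f \<subseteq> V})"
    unfolding Spec_def by (rule openin_Union) (auto intro: topology_generated_by_Basis)
  moreover have "\<Union>{basic_open M f | f. f \<in> carrier M \<and> basic_open M f \<subseteq> V} = V" using V by blast
  ultimately show "openin (Spec M) V" by simp
qed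

lemma openin_basic_open: "f \<in> carrier M \<Longrightarrow> openin (Spec M) (basic_open M f)"
  by (auto simp: openin_Spec_iff basic_open_def)

text \<open>The generic point, prime by integrality. It lies in every basic open set of a
  nonabsorbing element, so equality of fractions can be tested there.\<close>

lemma prime_ideal_absorb: "prime_ideal M {absorb M}"
  using submonoid_nonabsorb by (auto simp: prime_ideal_def absorb_closed absorb_mult nonabsorb_def)

lemma generic_in_basic_open: "f \<in> nonabsorb M \<Longrightarrow> {absorb M} \<in> basic_open M f"
  using prime_ideal_absorb by (simp add: basic_open_def nonabsorb_def)

text \<open>The greatest point of \<open>basic_open M g\<close>.\<close>

definition top_prime :: "'a \<Rightarrow> 'a set" where
  "top_prime g = {b \<in> carrier M. \<forall>n::nat. \<not> b divides g [^] n}"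

text \<open>The complement consists of the divisors of powers of \<open>g\<close>, the elements that
  become invertible together with \<open>g\<close>. It is closed under products because exponents
  add.\<close>

lemma prime_ideal_top_prime:
  assumes g: "g \<in> nonabsorb M"
  shows "prime_ideal M (top_prime g)"
proof -
  note gc = nonabsorb_carrier[OF g]
  have "\<not> absorb M divides g [^] (n::nat)" for n
    using nonabsorb_pow[OF g, of n] by (auto simp: factor_def absorb_mult nonabsorb_def)
  moreover have "a \<otimes> x \<in> top_prime g" if "a \<in> top_prime g" "x \<in> carrier M" for a x
  proof -
    have "\<not> (a \<otimes> x) divides g [^] n" for n :: nat
      using that by (auto simp: top_prime_def factor_def m_assoc)
    then show ?thesis using that by (simp add: top_prime_def)
  qed
  moreover have "submonoid (carrier M - top_prime g) M"
  proof
    show "\<one> \<in> carrier M - top_prime g"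
      by (auto simp: top_prime_def factor_def intro!: exI[of _ 0] bexI[of _ \<one>])
    fix a b assume "a \<in> carrier M - top_prime g" "b \<in> carrier M - top_prime g"
    then obtain m n c d where ab: "a \<in> carrier M" "b \<in> carrier M" "c \<in> carrier M" "d \<in> carrier M"
      "g [^] (m::nat) = a \<otimes> c" "g [^] (n::nat) = b \<otimes> d"
      by (auto simp: top_prime_def factor_def)
    then have "g [^] (m + n) = (a \<otimes> b) \<otimes> (c \<otimes> d)"
      using gc by (simp add: m_ac flip: nat_pow_mult)
    then have "(a \<otimes> b) divides g [^] (m + n)" using ab by (auto simp: factor_def)
    then show "a \<otimes> b \<in> carrier M - top_prime g" using ab by (auto simp: top_prime_def)
  qed auto
  ultimately show ?thesis
    using absorb_closed by (simp add: prime_ideal_def) (auto simp: top_prime_def)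
qed

lemma top_prime_in_basic_open: "g \<in> nonabsorb M \<Longrightarrow> top_prime g \<in> basic_open M g"
  using prime_ideal_top_prime[of g] nonabsorb_carrier[of g]
  by (auto simp: basic_open_def top_prime_def factor_def intro!: exI[of _ 1] bexI[of _ \<one>])

lemma le_top_prime:
  assumes "Q \<in> basic_open M g" "g \<in> carrier M"
  shows "Q \<subseteq> top_prime g"
proof
  fix b assume b: "b \<in> Q"
  have Q: "prime_ideal M Q" "g \<notin> Q" using assms by (auto simp: basic_open_def)
  then have "b \<in> carrier M" using b by (auto simp: prime_ideal_def)
  moreover have "\<not> b divides g [^] n" for n :: nat
    using Q b assms(2) prime_ideal_pow[of Q g n] by (auto simp: factor_def prime_ideal_def)
  ultimately show "b \<in> top_prime g" by (simp add: top_prime_def)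
qed

text \<open>Avoiding \<open>f\<close> is inherited by smaller primes, so open sets are closed
  downwards, and every point of \<open>basic_open M g\<close> lies below
  \<open>top_prime g\<close>.\<close>

lemma basic_open_subset_of_top_prime:
  assumes V: "openin (Spec M) V" and g: "g \<in> carrier M" and top: "top_prime g \<in> V"
  shows "basic_open M g \<subseteq> V"
proof
  fix Q assume Q: "Q \<in> basic_open M g"
  obtain f where "f \<in> carrier M" "top_prime g \<in> basic_open M f" "basic_open M f \<subseteq> V"
    using V top by (auto simp: openin_Spec_iff)
  then show "Q \<in> V" using le_top_prime[OF Q g] Q by (auto simp: basic_open_def)
qed

section \<open>Fractions as sections of the structure sheaf\<close>

abbreviation sections :: "'a set set \<Rightarrow> ('a set \<Rightarrow> ('a \<times> 'a) set) binoid" where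
  "sections \<equiv> bsec (structure_sheaf M)"

lemma fraction_in_stalk:
  assumes "P \<in> basic_open M f" "a \<in> carrier M" "f \<in> carrier M"
  shows "fraction M (carrier M - P) a f \<in> carrier (stalk M P)"
proof -
  have P: "prime_ideal M P" "f \<in> carrier M - P" using assms by (auto simp: basic_open_def)
  have "carrier (stalk M P) =
      {fraction M (carrier M - P) a s | a s. a \<in> carrier M \<and> s \<in> carrier M - P}"
    unfolding stalk_def
    by (rule carrier_localization[OF prime_ideal_submonoid[OF P(1)] prime_ideal_nonabsorb[OF P(1)]])
  then show ?thesis using P(2) assms(2) by blast
qed

text \<open>A germ given by a fraction with admissible denominator lies in the stalk automatically,
  so of the function space only extensionality remains to be checked.\<close>

lemma section_iff:
  "s \<in> carrier (sections V) \<longleftrightarrow> s \<in> extensional V \<and>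
     (\<forall>P\<in>V. \<exists>a\<in>carrier M. \<exists>f\<in>carrier M. P \<in> basic_open M f \<and> basic_open M f \<subseteq> V \<and>
        (\<forall>Q\<in>basic_open M f. s Q = fraction M (carrier M - Q) a f))"
    (is "_ \<longleftrightarrow> _ \<and> ?local")
proof -
  have "s P \<in> carrier (stalk M P)" if ?local "P \<in> V" for P
  proof -
    obtain a f where "a \<in> carrier M" "f \<in> carrier M" "P \<in> basic_open M f"
      "s P = fraction M (carrier M - P) a f"
      using bspec[OF \<open>?local\<close> \<open>P \<in> V\<close>] by (elim bexE conjE) (use bspec in blast)
    then show ?thesis using fraction_in_stalk by simp
  qed
  then have "s \<in> (\<Pi>\<^sub>E P\<in>V. carrier (stalk M P)) \<longleftrightarrow> s \<in> extensional V" if ?local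
    using that unfolding PiE_iff by simp
  moreover have "s \<in> carrier (sections V) \<longleftrightarrow> s \<in> (\<Pi>\<^sub>E P\<in>V. carrier (stalk M P)) \<and> ?local"
    unfolding structure_sheaf_def binoid_presheaf.simps partial_object.simps mem_Collect_eq ..
  ultimately show ?thesis by argo
qed

lemma section_extensional: "s \<in> carrier (sections V) \<Longrightarrow> s \<in> extensional V"
  by (simp add: section_iff)

lemma section_eqI:
  "s \<in> carrier (sections V) \<Longrightarrow> t \<in> carrier (sections V) \<Longrightarrow> (\<And>P. P \<in> V \<Longrightarrow> s P = t P) \<Longrightarrow> s = t"
  by (meson section_extensional extensionalityI)

lemma section_local:
  assumes "s \<in> carrier (sections V)" "P \<in> V"
  obtains a f where "a \<in> carrier M" "f \<in> carrier M" "P \<in> basic_open M f" "basic_open M f \<subseteq> V"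
    "\<And>Q. Q \<in> basic_open M f \<Longrightarrow> s Q = fraction M (carrier M - Q) a f"
proof -
  have "\<exists>a\<in>carrier M. \<exists>f\<in>carrier M. P \<in> basic_open M f \<and> basic_open M f \<subseteq> V \<and>
        (\<forall>Q\<in>basic_open M f. s Q = fraction M (carrier M - Q) a f)"
    using assms(1)[unfolded section_iff, THEN conjunct2] assms(2) by (rule bspec)
  then obtain a f where af: "a \<in> carrier M" "f \<in> carrier M" "P \<in> basic_open M f" "basic_open M f \<subseteq> V"
    and eq: "\<forall>Q\<in>basic_open M f. s Q = fraction M (carrier M - Q) a f"
    by (elim bexE conjE) (rule that)
  show ?thesis by (rule that[OF af bspec[OF eq]])
qed

lemma section_in_stalk: "s \<in> carrier (sections V) \<Longrightarrow> P \<in> V \<Longrightarrow> s P \<in> carrier (stalk M P)"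
  by (elim section_local) (auto simp: fraction_in_stalk)

lemma mult_sections: "s \<otimes>\<^bsub>sections V\<^esub> t = (\<lambda>P\<in>V. s P \<otimes>\<^bsub>stalk M P\<^esub> t P)"
  by (simp add: structure_sheaf_def)

lemma mult_fraction_basic_open:
  assumes "P \<in> basic_open M f" "P \<in> basic_open M g"
    and "a \<in> carrier M" "f \<in> carrier M" "b \<in> carrier M" "g \<in> carrier M"
  shows "fraction M (carrier M - P) a f \<otimes>\<^bsub>stalk M P\<^esub> fraction M (carrier M - P) b g =
    fraction M (carrier M - P) (a \<otimes> b) (f \<otimes> g)"
  using assms by (intro stalk_mult_fraction) (auto simp: basic_open_def)

lemma fraction_basic_open_eq_iff:
  assumes "P \<in> basic_open M f" "P \<in> basic_open M g"
    and "a \<in> carrier M" "f \<in> carrier M" "b \<in> carrier M" "g \<in> carrier M"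
  shows "fraction M (carrier M - P) a f = fraction M (carrier M - P) b g \<longleftrightarrow> a \<otimes> g = b \<otimes> f"
  using assms by (intro stalk_fraction_eq_iff) (auto simp: basic_open_def)

definition frac :: "'a set set \<Rightarrow> 'a \<Rightarrow> 'a \<Rightarrow> 'a set \<Rightarrow> ('a \<times> 'a) set" where
  "frac V a f = (\<lambda>P\<in>V. fraction M (carrier M - P) a f)"

lemma frac_section:
  assumes V: "openin (Spec M) V" and "V \<subseteq> basic_open M f" "a \<in> carrier M" "f \<in> carrier M"
  shows "frac V a f \<in> carrier (sections V)"
  unfolding section_iff
proof (intro conjI ballI)
  fix P assume P: "P \<in> V"
  then obtain g where g: "g \<in> carrier M" "P \<in> basic_open M g" "basic_open M g \<subseteq> V"
    using V by (auto simp: openin_Spec_iff)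
  \<comment> \<open>The definition of a section wants the denominator itself to cut out a
    neighbourhood inside \<open>V\<close>, which \<open>f\<close> need not do. Expanding the
    fraction by \<open>g\<close> repairs this.\<close>
  have "frac V a f Q = fraction M (carrier M - Q) (a \<otimes> g) (f \<otimes> g)" if Q: "Q \<in> basic_open M g" for Q
  proof -
    have "frac V a f Q = fraction M (carrier M - Q) a f" using g Q by (auto simp: frac_def)
    also have "\<dots> = fraction M (carrier M - Q) (a \<otimes> g) (f \<otimes> g)"
      using assms g Q by (subst fraction_basic_open_eq_iff) (auto simp: basic_open_mult m_ac)
    finally show ?thesis .
  qed
  then show "\<exists>b\<in>carrier M. \<exists>h\<in>carrier M. P \<in> basic_open M h \<and> basic_open M h \<subseteq> V \<and>
      (\<forall>Q\<in>basic_open M h. frac V a f Q = fraction M (carrier M - Q) b h)"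
    using assms g P
    by (intro bexI[of _ "a \<otimes> g"] bexI[of _ "f \<otimes> g"]) (auto simp: basic_open_mult)
qed (simp add: frac_def)

text \<open>Equality at the generic point already gives the cross-multiplied equation, and that
  equation gives equality at every other point.\<close>

lemma frac_eq_iff:
  assumes "{absorb M} \<in> V" "V \<subseteq> basic_open M f" "V \<subseteq> basic_open M g"
    and "a \<in> carrier M" "f \<in> carrier M" "b \<in> carrier M" "g \<in> carrier M"
  shows "frac V a f = frac V b g \<longleftrightarrow> a \<otimes> g = b \<otimes> f"
proof
  assume "frac V a f = frac V b g"
  then have "frac V a f {absorb M} = frac V b g {absorb M}" by simp
  then show "a \<otimes> g = b \<otimes> f"
    using assms fraction_basic_open_eq_iff[of "{absorb M}" f g a b] by (auto simp: frac_def)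
next
  assume "a \<otimes> g = b \<otimes> f"
  then show "frac V a f = frac V b g"
    using assms unfolding frac_def
    by (intro restrict_ext) (simp add: fraction_basic_open_eq_iff subset_iff)
qed

lemma mult_frac:
  assumes "V \<subseteq> basic_open M f" "V \<subseteq> basic_open M g"
    and "a \<in> carrier M" "f \<in> carrier M" "b \<in> carrier M" "g \<in> carrier M"
  shows "frac V a f \<otimes>\<^bsub>sections V\<^esub> frac V b g = frac V (a \<otimes> b) (f \<otimes> g)"
  unfolding mult_sections frac_def using assms
  by (intro restrict_ext) (simp add: mult_fraction_basic_open subset_iff)

lemma bres_frac: "W \<subseteq> V \<Longrightarrow> bres (structure_sheaf M) V W (frac V a f) = frac W a f"
  unfolding structure_sheaf_def frac_def by (auto simp: fun_eq_iff)

lemma one_sections: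
  assumes "V \<subseteq> {P. prime_ideal M P}" shows "\<one>\<^bsub>sections V\<^esub> = frac V \<one> \<one>"
  unfolding structure_sheaf_def frac_def stalk_def binoid_presheaf.simps binoid.simps monoid.simps
  by (rule restrict_ext)
    (use assms in \<open>auto simp: one_localization[OF prime_ideal_submonoid prime_ideal_nonabsorb]\<close>)

lemma absorb_sections:
  assumes "V \<subseteq> {P. prime_ideal M P}" shows "absorb (sections V) = frac V (absorb M) \<one>"
  unfolding structure_sheaf_def frac_def stalk_def binoid_presheaf.simps binoid.simps monoid.simps
  by (rule restrict_ext)
    (use assms in \<open>auto simp: absorb_localization[OF prime_ideal_submonoid prime_ideal_nonabsorb]\<close>)

lemma frac_one:
  assumes "V \<subseteq> basic_open M f" "f \<in> carrier M" shows "frac V f f = \<one>\<^bsub>sections V\<^esub>"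
proof -
  have "V \<subseteq> {P. prime_ideal M P}" using assms by (auto simp: basic_open_def)
  then show ?thesis
    unfolding one_sections[OF \<open>V \<subseteq> {P. prime_ideal M P}\<close>] frac_def
    using assms by (intro restrict_ext, subst fraction_basic_open_eq_iff)
      (auto simp: basic_open_one)
qed

text \<open>Near the greatest point the section is one fraction \<open>b\<close> over
  \<open>f\<close>. There \<open>f\<close> divides some \<open>g [^] n\<close>, and
  \<open>D f\<close> contains all of \<open>D g\<close>; expanding by the cofactor \<open>c\<close>
  gives the denominator \<open>g [^] n\<close> everywhere.\<close>

lemma section_basic_open:
  assumes g: "g \<in> nonabsorb M" and s: "s \<in> carrier (sections (basic_open M g))"
  obtains a and n :: nat where "a \<in> carrier M" "s = frac (basic_open M g) a (g [^] n)"
proof -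
  note gc = nonabsorb_carrier[OF g]
  obtain b f where b: "b \<in> carrier M" "f \<in> carrier M" "top_prime g \<in> basic_open M f"
    and eq: "\<And>Q. Q \<in> basic_open M f \<Longrightarrow> s Q = fraction M (carrier M - Q) b f"
    using section_local[OF s top_prime_in_basic_open[OF g]] by metis
  then obtain n c where c: "c \<in> carrier M" "g [^] (n::nat) = f \<otimes> c"
    by (auto simp: basic_open_def top_prime_def factor_def)
  have "s Q = fraction M (carrier M - Q) (b \<otimes> c) (g [^] n)" if Q: "Q \<in> basic_open M g" for Q
  proof -
    have "Q \<in> basic_open M f" using Q le_top_prime[OF Q gc] b(3) by (auto simp: basic_open_def)
    moreover have "Q \<in> basic_open M (g [^] n)"
      using Q prime_ideal_pow[of Q g n] gc by (auto simp: basic_open_def)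
    ultimately show ?thesis
      using b c gc by (simp add: eq fraction_basic_open_eq_iff) (simp add: m_ac)
  qed
  then have "s = frac (basic_open M g) (b \<otimes> c) (g [^] n)"
    using section_extensional[OF s] unfolding frac_def
    by (intro extensionalityI[of _ "basic_open M g"]) auto
  then show ?thesis using that b c by blast
qed

section \<open>The structure sheaf is a sheaf of binoids\<close>

lemma sections_mult_closed:
  assumes s: "s \<in> carrier (sections V)" and t: "t \<in> carrier (sections V)"
  shows "s \<otimes>\<^bsub>sections V\<^esub> t \<in> carrier (sections V)"
  unfolding section_iff
proof (intro conjI ballI)
  fix P assume P: "P \<in> V"
  obtain a f where f: "a \<in> carrier M" "f \<in> carrier M" "P \<in> basic_open M f" "basic_open M f \<subseteq> V"
    "\<And>Q. Q \<in> basic_open M f \<Longrightarrow> s Q = fraction M (carrier M - Q) a f"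
    using section_local[OF s P] by blast
  obtain b g where g: "b \<in> carrier M" "g \<in> carrier M" "P \<in> basic_open M g" "basic_open M g \<subseteq> V"
    "\<And>Q. Q \<in> basic_open M g \<Longrightarrow> t Q = fraction M (carrier M - Q) b g"
    using section_local[OF t P] by blast
  have "(s \<otimes>\<^bsub>sections V\<^esub> t) Q = fraction M (carrier M - Q) (a \<otimes> b) (f \<otimes> g)"
    if "Q \<in> basic_open M (f \<otimes> g)" for Q
    using that f g by (auto simp: mult_sections basic_open_mult mult_fraction_basic_open subset_iff)
  then show "\<exists>c\<in>carrier M. \<exists>h\<in>carrier M. P \<in> basic_open M h \<and> basic_open M h \<subseteq> V \<and>
      (\<forall>Q\<in>basic_open M h. (s \<otimes>\<^bsub>sections V\<^esub> t) Q = fraction M (carrier M - Q) c h)"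
    using f(1-4) g(1-4)
    by (intro bexI[of _ "a \<otimes> b"] bexI[of _ "f \<otimes> g"]) (auto simp: basic_open_mult)
qed (simp add: mult_sections)

lemma binoid_sections:
  assumes V: "openin (Spec M) V"
  shows "binoid (sections V)"
proof -
  have primes: "V \<subseteq> {P. prime_ideal M P}" using V by (simp add: openin_Spec_iff)
  have stalk: "comm_monoid (stalk M P)" if "P \<in> V" for P
    using that primes binoid_stalk binoid.axioms(1) by blast
  note stalk' = comm_monoid.axioms(1)[OF stalk]
  have "comm_monoid (sections V)"
  proof (rule comm_monoidI)
    show one: "\<one>\<^bsub>sections V\<^esub> \<in> carrier (sections V)"
      unfolding one_sections[OF primes] using V primes by (intro frac_section) (auto simp: basic_open_one)
    fix s assume s: "s \<in> carrier (sections V)"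
    show "\<one>\<^bsub>sections V\<^esub> \<otimes>\<^bsub>sections V\<^esub> s = s"
    proof (rule section_eqI[OF sections_mult_closed[OF one s] s])
      fix P assume "P \<in> V"
      then show "(\<one>\<^bsub>sections V\<^esub> \<otimes>\<^bsub>sections V\<^esub> s) P = s P"
        using stalk' section_in_stalk[OF s]
        by (simp add: mult_sections monoid.l_one) (simp add: structure_sheaf_def monoid.l_one)
    qed
    fix t assume t: "t \<in> carrier (sections V)"
    show "s \<otimes>\<^bsub>sections V\<^esub> t = t \<otimes>\<^bsub>sections V\<^esub> s"
      unfolding mult_sections
      by (rule restrict_ext) (rule comm_monoid.m_comm[OF stalk section_in_stalk[OF s] section_in_stalk[OF t]])
    fix r assume r: "r \<in> carrier (sections V)"
    show "s \<otimes>\<^bsub>sections V\<^esub> t \<otimes>\<^bsub>sections V\<^esub> r = s \<otimes>\<^bsub>sections V\<^esub> (t \<otimes>\<^bsub>sections V\<^esub> r)"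
      unfolding mult_sections
      by (rule restrict_ext)
        (simp add: monoid.m_assoc[OF stalk' section_in_stalk[OF s] section_in_stalk[OF t] section_in_stalk[OF r]])
  qed (rule sections_mult_closed)
  moreover have absorb: "absorb (sections V) \<in> carrier (sections V)"
    unfolding absorb_sections[OF primes]
    using V primes absorb_closed by (intro frac_section) (auto simp: basic_open_one)
  moreover have "absorb (sections V) \<otimes>\<^bsub>sections V\<^esub> s = absorb (sections V)"
    if s: "s \<in> carrier (sections V)" for s
  proof (rule section_eqI[OF sections_mult_closed[OF absorb s] absorb])
    fix P assume "P \<in> V"
    then show "(absorb (sections V) \<otimes>\<^bsub>sections V\<^esub> s) P = absorb (sections V) P"
      using section_in_stalk[OF s] primes binoid.absorb_mult[OF binoid_stalk]
      by (simp add: mult_sections) (simp add: structure_sheaf_def subset_iff)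
  qed
  ultimately show ?thesis by (simp add: binoid_def binoid_axioms_def)
qed

lemma bres_section:
  assumes V: "openin (Spec M) V" and W: "openin (Spec M) W" "W \<subseteq> V" and s: "s \<in> carrier (sections V)"
  shows "restrict s W \<in> carrier (sections W)"
  unfolding section_iff
proof (intro conjI ballI)
  fix P assume P: "P \<in> W"
  obtain a f where f: "a \<in> carrier M" "f \<in> carrier M" "P \<in> basic_open M f" "basic_open M f \<subseteq> V"
    "\<And>Q. Q \<in> basic_open M f \<Longrightarrow> s Q = fraction M (carrier M - Q) a f"
    using section_local[OF s] W P by blast
  obtain g where g: "g \<in> carrier M" "P \<in> basic_open M g" "basic_open M g \<subseteq> W"
    using W P by (auto simp: openin_Spec_iff)
  have "restrict s W Q = fraction M (carrier M - Q) (a \<otimes> g) (f \<otimes> g)"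
    if "Q \<in> basic_open M (f \<otimes> g)" for Q
  proof -
    have Q: "Q \<in> basic_open M f" "Q \<in> basic_open M g" using that f g by (auto simp: basic_open_mult)
    then have "restrict s W Q = fraction M (carrier M - Q) a f" using f(5) g by auto
    also have "\<dots> = fraction M (carrier M - Q) (a \<otimes> g) (f \<otimes> g)"
      using f(1,2) g Q by (subst fraction_basic_open_eq_iff) (auto simp: basic_open_mult m_ac)
    finally show ?thesis .
  qed
  then show "\<exists>b\<in>carrier M. \<exists>h\<in>carrier M. P \<in> basic_open M h \<and> basic_open M h \<subseteq> W \<and>
      (\<forall>Q\<in>basic_open M h. restrict s W Q = fraction M (carrier M - Q) b h)"
    using f(1-4) g
    by (intro bexI[of _ "a \<otimes> g"] bexI[of _ "f \<otimes> g"]) (auto simp: basic_open_mult)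
qed simp

lemma glue_sections:
  assumes \<sigma>: "\<And>W. W \<in> \<W> \<Longrightarrow> \<sigma> W \<in> carrier (sections W)"
    and compat: "\<And>W W'. W \<in> \<W> \<Longrightarrow> W' \<in> \<W> \<Longrightarrow> restrict (\<sigma> W) (W \<inter> W') = restrict (\<sigma> W') (W \<inter> W')"
  shows "\<exists>!s. s \<in> carrier (sections (\<Union>\<W>)) \<and> (\<forall>W\<in>\<W>. restrict s W = \<sigma> W)"
proof -
  \<comment> \<open>The choice of a member containing \<open>P\<close> is harmless: compatibility on
    intersections gives the same germ for all of them.\<close>
  define s where "s = (\<lambda>P\<in>\<Union>\<W>. \<sigma> (SOME W. W \<in> \<W> \<and> P \<in> W) P)"
  have s: "s P = \<sigma> W P" if "W \<in> \<W>" "P \<in> W" for W P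
  proof -
    define W' where "W' = (SOME W. W \<in> \<W> \<and> P \<in> W)"
    have W': "W' \<in> \<W> \<and> P \<in> W'" unfolding W'_def using that by (metis (mono_tags, lifting) someI)
    then have "restrict (\<sigma> W) (W \<inter> W') P = restrict (\<sigma> W') (W \<inter> W') P"
      using compat that by metis
    then show ?thesis using that W' unfolding s_def by (auto simp flip: W'_def)
  qed
  have "s \<in> carrier (sections (\<Union>\<W>))"
    unfolding section_iff
  proof (intro conjI ballI)
    fix P assume "P \<in> \<Union>\<W>"
    then obtain W where W: "W \<in> \<W>" "P \<in> W" by blast
    obtain a f where "a \<in> carrier M" "f \<in> carrier M" "P \<in> basic_open M f" "basic_open M f \<subseteq> W"
      "\<And>Q. Q \<in> basic_open M f \<Longrightarrow> \<sigma> W Q = fraction M (carrier M - Q) a f"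
      using section_local[OF \<sigma>[OF W(1)] W(2)] by blast
    then show "\<exists>a\<in>carrier M. \<exists>f\<in>carrier M. P \<in> basic_open M f \<and> basic_open M f \<subseteq> \<Union>\<W> \<and>
      (\<forall>Q\<in>basic_open M f. s Q = fraction M (carrier M - Q) a f)"
      using W s by (intro bexI[of _ a] bexI[of _ f]) auto
  qed (simp add: s_def)
  moreover have "restrict s W = \<sigma> W" if "W \<in> \<W>" for W
    using section_extensional[OF \<sigma>[OF that]] s that
    by (intro extensionalityI[of _ W]) auto
  moreover have "t = s" if "t \<in> carrier (sections (\<Union>\<W>))" "\<forall>W\<in>\<W>. restrict t W = \<sigma> W" for t
  proof (rule section_eqI[OF that(1) calculation(1)])
    fix P assume "P \<in> \<Union>\<W>"
    then obtain W where W: "W \<in> \<W>" "P \<in> W" by blast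
    then have "t P = restrict t W P" by simp
    also have "\<dots> = s P" using that(2) W s by simp
    finally show "t P = s P" .
  qed
  ultimately show ?thesis by blast
qed

lemma binoid_sheaf_structure_sheaf:
  assumes U: "openin (Spec M) U"
  shows "binoid_sheaf (subtopology (Spec M) U) (structure_sheaf M)"
proof (rule binoid_sheaf.intro)
  let ?X = "subtopology (Spec M) U"
  have opn: "openin (Spec M) V" if "openin ?X V" for V
    using that U by (simp add: openin_open_subtopology)
  have res: "bres (structure_sheaf M) V W s = restrict s W" for V W s
    by (simp add: structure_sheaf_def)
  show "binoid (sections V)" if "openin ?X V" for V using opn[OF that] by (rule binoid_sections)
  show "bres (structure_sheaf M) V W \<one>\<^bsub>sections V\<^esub> = \<one>\<^bsub>sections W\<^esub>"
    if "openin ?X V" "openin ?X W" "W \<subseteq> V" for V W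
    using that by (auto simp: structure_sheaf_def fun_eq_iff)
  show "sheaf_of_act_sets ?X (structure_sheaf M) (regular_act (structure_sheaf M))"
    unfolding sheaf_of_act_sets_def
  proof (intro conjI allI impI ballI)
    show "presheaf_of_sets ?X (regular_act (structure_sheaf M))"
      unfolding presheaf_of_sets_def regular_act_def act_presheaf.simps res
    proof (intro conjI allI impI ballI funcsetI)
      fix V s assume "openin ?X V" "s \<in> carrier (sections V)"
      then show "restrict s V = s" by (simp add: section_extensional extensional_restrict)
    next
      fix V W Z s assume "openin ?X V \<and> openin ?X W \<and> openin ?X Z \<and> Z \<subseteq> W \<and> W \<subseteq> V"
      then show "restrict (restrict s W) Z = restrict s Z" by (auto simp: fun_eq_iff)
    qed (use opn bres_section in blast)
    show "gluing_axiom ?X (regular_act (structure_sheaf M))"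
      unfolding gluing_axiom_def regular_act_def act_presheaf.simps res
      by (intro allI impI glue_sections) auto
  next
    fix V assume "openin ?X V"
    then interpret binoid "sections V" using opn binoid_sections by blast
    show "binoid_act (sections V) (sec (regular_act (structure_sheaf M)) V)
        (act (regular_act (structure_sheaf M)) V) (pt (regular_act (structure_sheaf M)) V)"
      unfolding binoid_act_def regular_act_def
      by (auto simp: absorb_closed absorb_mult m_assoc m_comm[of _ "absorb (sections V)"])
  qed (auto simp: regular_act_def structure_sheaf_def fun_eq_iff)
qed

end

section \<open>Binoids with a prime element\<close>

text \<open>Beyond primality, \<open>decomposition\<close> says that the \<open>x\<close>-adic
  valuation is finite on nonabsorbing elements.\<close>

locale prime_element_binoid = integral_cancellative_binoid M for M :: "('a, 'z) binoid_scheme" (structure) +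
  fixes x
  assumes x_nonabsorb: "x \<in> nonabsorb M"
    and x_prime: "Divisibility.prime M x"
    and decomposition: "b \<in> nonabsorb M \<Longrightarrow> \<exists>n::nat. \<exists>c\<in>carrier M. \<not> x divides c \<and> b = x [^] n \<otimes> c"
begin

lemma x_carrier: "x \<in> carrier M"
  using x_nonabsorb by (rule nonabsorb_carrier)

lemma not_x_dvd_mult:
  "a \<in> carrier M \<Longrightarrow> b \<in> carrier M \<Longrightarrow> \<not> x divides a \<Longrightarrow> \<not> x divides b \<Longrightarrow> \<not> x divides (a \<otimes> b)"
  using x_prime unfolding Divisibility.prime_def by blast

lemma not_x_dvd_one: "\<not> x divides \<one>"
proof
  assume "x divides \<one>"
  then obtain c where "c \<in> carrier M" "\<one> = x \<otimes> c" by (auto simp: factor_def)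
  then have "x \<in> Units M" using x_carrier m_comm[of x c] by (auto simp: Units_def)
  then show False using x_prime by (simp add: Divisibility.prime_def)
qed

lemma not_x_dvd_pow: "a \<in> carrier M \<Longrightarrow> \<not> x divides a \<Longrightarrow> \<not> x divides (a [^] (n::nat))"
  by (induction n) (simp_all add: not_x_dvd_one not_x_dvd_mult)

lemma not_x_dvd_nonabsorb: "a \<in> carrier M \<Longrightarrow> \<not> x divides a \<Longrightarrow> a \<in> nonabsorb M"
  using mult_absorb[OF x_carrier] absorb_closed by (auto simp: nonabsorb_def factor_def)

lemma not_x_dvd_left:
  "a \<in> carrier M \<Longrightarrow> b \<in> carrier M \<Longrightarrow> \<not> x divides (a \<otimes> b) \<Longrightarrow> \<not> x divides a"
  using x_carrier by (auto simp: factor_def m_assoc)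

text \<open>After cancelling the smaller power of \<open>x\<close>, any power left over would make
  \<open>x\<close> divide an element that it does not divide.\<close>

lemma decomposition_unique:
  assumes "a \<in> carrier M" "b \<in> carrier M" "\<not> x divides a" "\<not> x divides b"
    and "x [^] (m::nat) \<otimes> a = x [^] (n::nat) \<otimes> b"
  shows "m = n \<and> a = b"
proof -
  have le: "m = n \<and> a = b"
    if "m \<le> n" "a \<in> carrier M" "b \<in> carrier M" "\<not> x divides a" "x [^] m \<otimes> a = x [^] n \<otimes> b"
    for m n :: nat and a b
  proof -
    have "x [^] n = x [^] m \<otimes> x [^] (n - m)"
      using nat_pow_mult[OF x_carrier, of m "n - m"] \<open>m \<le> n\<close> by simp
    then have "x [^] m \<otimes> a = x [^] m \<otimes> (x [^] (n - m) \<otimes> b)"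
      using that(3,5) x_carrier by (simp add: m_assoc)
    then have a: "a = x [^] (n - m) \<otimes> b"
      by (rule nonabsorb_cancel[OF nonabsorb_pow[OF x_nonabsorb], rotated -1])
        (use that(2,3) x_carrier in simp_all)
    have "n - m = 0"
    proof (rule ccontr)
      assume "n - m \<noteq> 0"
      then obtain k where "n - m = Suc k" by (cases "n - m") auto
      then have "x [^] (n - m) \<otimes> b = x \<otimes> (x [^] k \<otimes> b)"
        using that(3) x_carrier by (simp add: m_ac)
      with a have "x divides a"
        using that(3) x_carrier by (intro dividesI[of "x [^] k \<otimes> b"]) simp_all
      then show False using that(4) by blast
    qed
    then show ?thesis using a that by simp
  qed
  show ?thesis using le[of m n a b] le[of n m b a] assms by (cases "m \<le> n") auto
qed

end

locale sheaf_at_prime_element =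
  prime_element_binoid M x + act_sheaf "subtopology (Spec M) U" "structure_sheaf M" F
  for M :: "('a, 'z) binoid_scheme" (structure) and x U
    and F :: "('a set, 'a set \<Rightarrow> ('a \<times> 'a) set, 's) act_presheaf" +
  fixes e\<^sub>x
  assumes U: "openin (Spec M) U" and x_U: "basic_open M x \<subseteq> U"
    and e\<^sub>x: "generator (subtopology (Spec M) U) (structure_sheaf M) F (basic_open M x) e\<^sub>x"
begin

abbreviation "gen \<equiv> generator (subtopology (Spec M) U) (structure_sheaf M) F"
abbreviation "D \<equiv> basic_open M"

lemma opn: "f \<in> carrier M \<Longrightarrow> D f \<subseteq> U \<Longrightarrow> openin (subtopology (Spec M) U) (D f)"
  by (simp add: openin_open_subtopology[OF U] openin_basic_open)

lemma opn_x: "openin (subtopology (Spec M) U) (D x)"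
  by (simp add: opn x_carrier x_U)

lemma D_pow: "f \<in> carrier M \<Longrightarrow> D f \<subseteq> D (f [^] (n::nat))"
  using prime_ideal_pow by (auto simp: basic_open_def)

lemma frac_closed:
  "f \<in> carrier M \<Longrightarrow> D f \<subseteq> D g \<Longrightarrow> g \<in> carrier M \<Longrightarrow> a \<in> carrier M \<Longrightarrow>
     frac (D f) a g \<in> carrier (sections (D f))"
  by (rule frac_section) (simp_all add: openin_basic_open)

lemma frac_D_eq_iff:
  assumes "f \<in> nonabsorb M" "D f \<subseteq> D g" "D f \<subseteq> D h"
    and "a \<in> carrier M" "g \<in> carrier M" "b \<in> carrier M" "h \<in> carrier M"
  shows "frac (D f) a g = frac (D f) b h \<longleftrightarrow> a \<otimes> h = b \<otimes> g"
  using assms generic_in_basic_open by (intro frac_eq_iff) auto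

text \<open>The inverse is \<open>b\<close> over \<open>h\<close>: the product of the two fractions
  has equal numerator and denominator.\<close>

lemma frac_unit:
  assumes "f \<in> carrier M" "D f \<subseteq> D g" "D f \<subseteq> D h"
    and "a \<in> carrier M" "g \<in> carrier M" "b \<in> carrier M" "h \<in> carrier M" and "a \<otimes> b = g \<otimes> h"
  shows "frac (D f) a g \<in> Units (sections (D f))"
proof -
  have 1: "D f \<subseteq> D (g \<otimes> h)" using assms by (auto simp: basic_open_mult)
  have "frac (D f) a g \<otimes>\<^bsub>sections (D f)\<^esub> frac (D f) b h = \<one>\<^bsub>sections (D f)\<^esub>"
    "frac (D f) b h \<otimes>\<^bsub>sections (D f)\<^esub> frac (D f) a g = \<one>\<^bsub>sections (D f)\<^esub>"
    using assms frac_one[OF 1] by (simp_all add: mult_frac m_comm)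
  then show ?thesis
    using assms unfolding Units_def by (auto intro!: bexI[of _ "frac (D f) b h"] frac_closed)
qed

text \<open>This turns invertibility into divisibility in \<open>M\<close>: the numerator of a unit
  divides a power of \<open>f\<close>, which is what controls its valuation at
  \<open>x\<close>.\<close>

lemma unitE:
  assumes f: "f \<in> nonabsorb M" and u: "u \<in> Units (sections (D f))"
  obtains a b and i k :: nat where "a \<in> carrier M" "b \<in> carrier M" "u = frac (D f) a (f [^] i)"
    "a \<otimes> b = f [^] i \<otimes> f [^] k"
proof -
  note fc = nonabsorb_carrier[OF f]
  obtain v where v: "u \<in> carrier (sections (D f))" "v \<in> carrier (sections (D f))"
    "u \<otimes>\<^bsub>sections (D f)\<^esub> v = \<one>\<^bsub>sections (D f)\<^esub>"
    using u by (auto simp: Units_def)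
  obtain a and i :: nat where a: "a \<in> carrier M" "u = frac (D f) a (f [^] i)"
    using section_basic_open[OF f v(1)] .
  obtain b and k :: nat where b: "b \<in> carrier M" "v = frac (D f) b (f [^] k)"
    using section_basic_open[OF f v(2)] .
  have sub: "D f \<subseteq> D (f [^] i \<otimes> f [^] k)" using D_pow[OF fc] fc by (simp add: basic_open_mult)
  have D_one: "D f \<subseteq> D \<one>" unfolding basic_open_one by (auto simp: basic_open_def)
  have "frac (D f) (a \<otimes> b) (f [^] i \<otimes> f [^] k) = frac (D f) \<one> \<one>"
    using v(3) a b fc D_pow[OF fc] by (simp add: mult_frac frac_one[OF D_one])
  then have "a \<otimes> b = f [^] i \<otimes> f [^] k"
    using a b fc sub f D_one by (simp add: frac_D_eq_iff)
  then show ?thesis using that a b by blast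
qed

text \<open>The normalized generators: the transition to \<open>e\<^sub>x\<close> is the pure power
  of \<open>x\<close> with exponent \<open>r - j\<close>, kept as two naturals because the exponent
  may be negative.\<close>

definition adapted :: "'a \<Rightarrow> 's \<Rightarrow> nat \<Rightarrow> nat \<Rightarrow> bool" where
  "adapted f e r j \<longleftrightarrow> f \<in> carrier M \<and> \<not> x divides f \<and> D f \<subseteq> U \<and> gen (D f) e \<and>
     res F (D x) (D (f \<otimes> x)) e\<^sub>x =
       act F (D (f \<otimes> x)) (frac (D (f \<otimes> x)) (x [^] r) (x [^] j)) (res F (D f) (D (f \<otimes> x)) e)"

text \<open>A unit over \<open>D (f \<otimes> x)\<close> is a unit over \<open>D f\<close> times a power of \<open>x\<close>, because \<open>x\<close> is prime.\<close>

lemma adapted_exists: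
  assumes f: "f \<in> carrier M" "\<not> x divides f" "D f \<subseteq> U" and e: "gen (D f) e"
  obtains e' r j where "adapted f e' r j"
proof -
  note [simp] = x_carrier f(1)
  have fx: "f \<otimes> x \<in> nonabsorb M"
    using f not_x_dvd_nonabsorb x_nonabsorb by (simp add: nonabsorb_mult)
  have sub: "D (f \<otimes> x) \<subseteq> D f" "D (f \<otimes> x) \<subseteq> D x" by (auto simp: basic_open_mult)
  have op: "openin (subtopology (Spec M) U) (D f)" "openin (subtopology (Spec M) U) (D (f \<otimes> x))"
    using f sub by (auto intro!: opn)
  obtain u where u: "u \<in> Units (sections (D (f \<otimes> x)))"
    "res F (D x) (D (f \<otimes> x)) e\<^sub>x = act F (D (f \<otimes> x)) u (res F (D f) (D (f \<otimes> x)) e)"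
    using generators_unit[OF generator_restrict[OF e op sub(1)] generator_restrict[OF e\<^sub>x opn_x op(2) sub(2)] op(2)] .
  obtain a b i k where ab: "a \<in> carrier M" "b \<in> carrier M" "u = frac (D (f \<otimes> x)) a ((f \<otimes> x) [^] i)"
    "a \<otimes> b = (f \<otimes> x) [^] (i::nat) \<otimes> (f \<otimes> x) [^] (k::nat)"
    using unitE[OF fx u(1)] .
  have "a \<otimes> b \<in> nonabsorb M" unfolding ab(4) by (rule nonabsorb_mult[OF nonabsorb_pow[OF fx] nonabsorb_pow[OF fx]])
  then have "a \<in> nonabsorb M" "b \<in> nonabsorb M" using nonabsorb_factor ab by blast+
  then obtain r q a' b' where a': "a' \<in> carrier M" "\<not> x divides a'" "a = x [^] (r::nat) \<otimes> a'"
    and b': "b' \<in> carrier M" "\<not> x divides b'" "b = x [^] (q::nat) \<otimes> b'"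
    using decomposition by metis
  have pow_fx: "(f \<otimes> x) [^] n = x [^] n \<otimes> f [^] n" for n :: nat
    by (simp add: nat_pow_distrib m_comm)
  \<comment> \<open>Both sides are decompositions of the same element \<open>a \<otimes> b\<close>;
    by uniqueness the factors prime to \<open>x\<close> coincide, which makes \<open>a'\<close> over
    \<open>f [^] i\<close> invertible on all of \<open>D f\<close>.\<close>
  have "x [^] (r + q) \<otimes> (a' \<otimes> b') = a \<otimes> b"
    using a' b' by (simp add: m_ac flip: nat_pow_mult)
  also have "\<dots> = x [^] (i + k) \<otimes> (f [^] i \<otimes> f [^] k)"
    unfolding ab(4) by (simp add: pow_fx m_ac flip: nat_pow_mult)
  finally have "a' \<otimes> b' = f [^] i \<otimes> f [^] k"
    using decomposition_unique[of "a' \<otimes> b'" "f [^] i \<otimes> f [^] k" "r + q" "i + k"] a' b' f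
    by (simp add: not_x_dvd_mult not_x_dvd_pow)
  then have w: "frac (D f) a' (f [^] i) \<in> Units (sections (D f))"
    using a' b' D_pow by (intro frac_unit[of f _ "f [^] k" _ b']) auto
  \<comment> \<open>The part of the transition unit that is already invertible over
    \<open>D f\<close> is absorbed into the generator.\<close>
  let ?e = "act F (D f) (frac (D f) a' (f [^] i)) e"
  have subs: "D (f \<otimes> x) \<subseteq> D (f [^] i)" "D (f \<otimes> x) \<subseteq> D (x [^] i)"
    using sub D_pow[of f i] D_pow[of x i] by auto
  have "u = frac (D (f \<otimes> x)) (x [^] r) (x [^] i) \<otimes>\<^bsub>sections (D (f \<otimes> x))\<^esub> frac (D (f \<otimes> x)) a' (f [^] i)"
    unfolding ab(3) pow_fx a'(3) using subs a' by (simp add: mult_frac)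
  moreover have "res F (D f) (D (f \<otimes> x)) ?e =
      act F (D (f \<otimes> x)) (frac (D (f \<otimes> x)) a' (f [^] i)) (res F (D f) (D (f \<otimes> x)) e)"
    using op sub a' D_pow[of f i] generator_in_sec[OF e]
    by (simp add: res_act bres_frac frac_closed)
  ultimately have "res F (D x) (D (f \<otimes> x)) e\<^sub>x =
      act F (D (f \<otimes> x)) (frac (D (f \<otimes> x)) (x [^] r) (x [^] i)) (res F (D f) (D (f \<otimes> x)) ?e)"
    using u(2) op sub subs a' generator_in_sec[OF e] nonabsorb_carrier[OF fx]
    by (simp add: act_mult frac_closed res_closed)
  then have "adapted f ?e r i"
    unfolding adapted_def using f generator_unit_act[OF e w op(1)] by blast
  then show ?thesis by (rule that)
qed

text \<open>Over \<open>D (f \<otimes> f')\<close> the generators differ by a unit whose numerator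
  \<open>a\<close> divides a power of \<open>f \<otimes> f'\<close>, hence is prime to
  \<open>x\<close>. Comparing both with \<open>e\<^sub>x\<close> after inverting \<open>x\<close>
  yields two decompositions of one element. Uniqueness then equates the exponents and shows that the
  unit is one.\<close>

lemma adapted_compatible:
  assumes 1: "adapted f e r j" and 2: "adapted f' e' r' j'"
  shows "r + j' = r' + j" and "res F (D f) (D f \<inter> D f') e = res F (D f') (D f \<inter> D f') e'"
proof -
  have f: "f \<in> carrier M" "\<not> x divides f" "D f \<subseteq> U" "gen (D f) e"
    and f': "f' \<in> carrier M" "\<not> x divides f'" "D f' \<subseteq> U" "gen (D f') e'"
    using 1 2 by (simp_all add: adapted_def)
  note [simp] = x_carrier f(1) f'(1)
  let ?g = "f \<otimes> f'" let ?W = "D ?g" let ?Z = "D (?g \<otimes> x)"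
  have W: "D f \<inter> D f' = ?W" by (simp add: basic_open_mult)
  have g_ndvd: "\<not> x divides ?g" using f f' by (simp add: not_x_dvd_mult)
  then have g: "?g \<in> nonabsorb M" and gx: "?g \<otimes> x \<in> nonabsorb M"
    using not_x_dvd_nonabsorb x_nonabsorb nonabsorb_mult by simp_all
  have sub: "?W \<subseteq> D f" "?W \<subseteq> D f'" "?Z \<subseteq> ?W" "?Z \<subseteq> D (f \<otimes> x)" "?Z \<subseteq> D (f' \<otimes> x)"
    "D (f \<otimes> x) \<subseteq> D f" "D (f' \<otimes> x) \<subseteq> D f'" "?Z \<subseteq> D x" "?Z \<subseteq> D f" "?Z \<subseteq> D f'"
    "D (f \<otimes> x) \<subseteq> D x" "D (f' \<otimes> x) \<subseteq> D x"
    by (auto simp: basic_open_mult)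
  have op: "openin (subtopology (Spec M) U) (D f)" "openin (subtopology (Spec M) U) (D f')"
    "openin (subtopology (Spec M) U) ?W" "openin (subtopology (Spec M) U) ?Z"
    "openin (subtopology (Spec M) U) (D (f \<otimes> x))" "openin (subtopology (Spec M) U) (D (f' \<otimes> x))"
    using sub f f' by (intro opn; auto)+
  have genW: "gen ?W (res F (D f) ?W e)" "gen ?W (res F (D f') ?W e')"
    using generator_restrict[OF f(4) op(1,3) sub(1)] generator_restrict[OF f'(4) op(2,3) sub(2)] .
  obtain u where u: "u \<in> Units (sections ?W)" "res F (D f) ?W e = act F ?W u (res F (D f') ?W e')"
    using generators_unit[OF genW(2,1) op(3)] .
  obtain a b i k where ab: "a \<in> carrier M" "b \<in> carrier M" "u = frac ?W a (?g [^] i)"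
    "a \<otimes> b = ?g [^] (i::nat) \<otimes> ?g [^] (k::nat)"
    using unitE[OF g u(1)] .
  have "\<not> x divides (a \<otimes> b)"
    unfolding ab(4) using g_ndvd by (simp add: not_x_dvd_mult not_x_dvd_pow)
  then have a_ndvd: "\<not> x divides a" using ab not_x_dvd_left by blast
  note e = generator_in_sec[OF f(4)] and e' = generator_in_sec[OF f'(4)]
  have subs: "?Z \<subseteq> D (x [^] n)" "?Z \<subseteq> D (?g [^] n)" "?W \<subseteq> D (?g [^] n)"
    "D (f \<otimes> x) \<subseteq> D (x [^] n)" "D (f' \<otimes> x) \<subseteq> D (x [^] n)" for n :: nat
    using D_pow[of x n] D_pow[of ?g n] sub by auto
  \<comment> \<open>The defining relation of an adapted generator lives over
    \<open>D (f \<otimes> x)\<close>; here it is carried to the smaller set \<open>?Z\<close>, where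
    both generators can be compared with \<open>e\<^sub>x\<close>.\<close>
  have restr: "res F (D x) ?Z e\<^sub>x = act F ?Z (frac ?Z (x [^] r) (x [^] j)) (res F (D f) ?Z e)"
    if "adapted f e r j" "openin (subtopology (Spec M) U) (D f)"
      "openin (subtopology (Spec M) U) (D (f \<otimes> x))" "?Z \<subseteq> D (f \<otimes> x)" for f e r j
  proof -
    have f: "f \<in> carrier M" "e \<in> sec F (D f)"
      using that generator_in_sec by (simp_all add: adapted_def)
    then have s: "D (f \<otimes> x) \<subseteq> D f" "D (f \<otimes> x) \<subseteq> D x" "D (f \<otimes> x) \<subseteq> D (x [^] j)"
      using D_pow[of x j] by (auto simp: basic_open_mult)
    have "res F (D x) ?Z e\<^sub>x = res F (D (f \<otimes> x)) ?Z (res F (D x) (D (f \<otimes> x)) e\<^sub>x)"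
      using that s op opn_x generator_in_sec[OF e\<^sub>x] by (simp add: res_res)
    also have "\<dots> = res F (D (f \<otimes> x)) ?Z
        (act F (D (f \<otimes> x)) (frac (D (f \<otimes> x)) (x [^] r) (x [^] j)) (res F (D f) (D (f \<otimes> x)) e))"
      using that(1) by (simp add: adapted_def)
    also have "\<dots> = act F ?Z (frac ?Z (x [^] r) (x [^] j)) (res F (D f) ?Z e)"
      using that s f op by (simp add: res_act bres_frac frac_closed res_closed res_res)
    finally show ?thesis .
  qed
  have Z_pow: "?Z \<subseteq> D (x [^] j \<otimes> ?g [^] i)"
    using subs basic_open_mult[of "x [^] j" "?g [^] i"] by simp
  have "act F ?Z (frac ?Z (x [^] r') (x [^] j')) (res F (D f') ?Z e') =
      act F ?Z (frac ?Z (x [^] r) (x [^] j)) (res F (D f) ?Z e)"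
    using restr[OF 1 op(1,5) sub(4)] restr[OF 2 op(2,6) sub(5)] by simp
  also have "res F (D f) ?Z e = res F ?W ?Z (act F ?W u (res F (D f') ?W e'))"
    using op sub e by (simp add: res_res flip: u(2))
  also have "\<dots> = act F ?Z (frac ?Z a (?g [^] i)) (res F (D f') ?Z e')"
    unfolding ab(3) using op sub subs e' ab(1)
    by (simp add: res_act bres_frac frac_closed res_closed res_res)
  also have "act F ?Z (frac ?Z (x [^] r) (x [^] j)) \<dots> =
      act F ?Z (frac ?Z (x [^] r \<otimes> a) (x [^] j \<otimes> ?g [^] i)) (res F (D f') ?Z e')"
    using op sub subs e' ab(1)
    by (simp add: frac_closed res_closed mult_frac flip: act_mult)
  finally have "frac ?Z (x [^] r') (x [^] j') = frac ?Z (x [^] r \<otimes> a) (x [^] j \<otimes> ?g [^] i)"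
    using ab(1) subs Z_pow
    by (intro generator_cancel[OF generator_restrict[OF f'(4) op(2,4) sub(10)] op(4)] frac_closed) auto
  then have "x [^] r' \<otimes> (x [^] j \<otimes> ?g [^] i) = x [^] r \<otimes> a \<otimes> x [^] j'"
    using gx subs ab(1) Z_pow by (subst (asm) frac_D_eq_iff) auto
  then have "x [^] (r' + j) \<otimes> ?g [^] i = x [^] (r + j') \<otimes> a"
    using ab(1) by (simp add: m_ac flip: nat_pow_mult)
  \<comment> \<open>Neither \<open>?g [^] i\<close> nor \<open>a\<close> is divisible by
    \<open>x\<close>, so the powers of \<open>x\<close> and the remaining factors agree
    separately.\<close>
  then have *: "r' + j = r + j' \<and> ?g [^] i = a"
    using ab(1) a_ndvd g_ndvd by (intro decomposition_unique) (auto simp: not_x_dvd_pow)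
  then show "r + j' = r' + j" by simp
  have "u = \<one>\<^bsub>sections ?W\<^esub>" unfolding ab(3) using * subs(3)[of i] frac_one by auto
  then show "res F (D f) (D f \<inter> D f') e = res F (D f') (D f \<inter> D f') e'"
    unfolding W using u(2) op(3) generator_in_sec[OF genW(2)] by (simp add: act_one)
qed

lemma global_generator:
  assumes local: "\<And>P. P \<in> U \<Longrightarrow> \<exists>f\<in>carrier M. P \<in> D f \<and> D f \<subseteq> U \<and> (\<exists>e. gen (D f) e)"
  obtains e where "gen U e"
proof -
  note [simp] = x_carrier
  have ex: "\<exists>f e r j. P \<in> D f \<and> adapted f e r j" if P: "P \<in> U" "P \<notin> D x" for P
  proof -
    obtain f e where f: "f \<in> carrier M" "P \<in> D f" "D f \<subseteq> U" "gen (D f) e"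
      using local[OF P(1)] by blast
    then have "x \<in> P" "prime_ideal M P" "f \<notin> P" using P by (auto simp: basic_open_def)
    \<comment> \<open>A point outside \<open>D x\<close> contains \<open>x\<close>, hence all
      multiples of \<open>x\<close>, but it does not contain \<open>f\<close>.\<close>
    then have "\<not> x divides f" by (auto simp: factor_def prime_ideal_mult_iff)
    then show ?thesis using adapted_exists[OF f(1) _ f(3,4)] f(2) by metis
  qed
  show ?thesis
  \<comment> \<open>If \<open>U = D x\<close>, there is no outside point from which to read off an
    exponent, and \<open>e\<^sub>x\<close> is already global.\<close>
  proof (cases "U = D x")
    case True
    then show ?thesis using that e\<^sub>x by simp
  next
    case False
    then obtain P where "P \<in> U" "P \<notin> D x" using x_U by blast
    then obtain f\<^sub>0 e\<^sub>0 r\<^sub>0 j\<^sub>0 where 0: "adapted f\<^sub>0 e\<^sub>0 r\<^sub>0 j\<^sub>0" using ex by blast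
    \<comment> \<open>Over \<open>D (f\<^sub>0 \<otimes> x)\<close>, \<open>e\<^sub>x\<close> is
      \<open>e\<^sub>0\<close> times the power of \<open>x\<close> with exponent
      \<open>r\<^sub>0 - j\<^sub>0\<close>; the opposite power undoes it. One adapted generator
      fixes this scaling for all.\<close>
    define e\<^sub>1 where "e\<^sub>1 = act F (D x) (frac (D x) (x [^] j\<^sub>0) (x [^] r\<^sub>0)) e\<^sub>x"
    have gen1: "gen (D x) e\<^sub>1"
      unfolding e\<^sub>1_def
    proof (rule generator_unit_act[OF e\<^sub>x _ opn_x])
      show "frac (D x) (x [^] j\<^sub>0) (x [^] r\<^sub>0) \<in> Units (sections (D x))"
        using D_pow[of x] by (intro frac_unit[of x _ "x [^] j\<^sub>0" _ "x [^] r\<^sub>0"]) (auto simp: m_comm)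
    qed
    have compat1: "res F (D f) (D f \<inter> D x) e = res F (D x) (D f \<inter> D x) e\<^sub>1"
      if "adapted f e r j" for f e r j
    proof -
      have f: "f \<in> carrier M" "D f \<subseteq> U" "e \<in> sec F (D f)"
        and eq: "res F (D x) (D (f \<otimes> x)) e\<^sub>x =
          act F (D (f \<otimes> x)) (frac (D (f \<otimes> x)) (x [^] r) (x [^] j)) (res F (D f) (D (f \<otimes> x)) e)"
        using that generator_in_sec by (simp_all add: adapted_def)
      note [simp] = f(1)
      have sub: "D (f \<otimes> x) \<subseteq> D f" "D (f \<otimes> x) \<subseteq> D x" by (auto simp: basic_open_mult)
      then have subs: "D (f \<otimes> x) \<subseteq> D (x [^] n)" for n :: nat using D_pow[of x n] by auto
      have op: "openin (subtopology (Spec M) U) (D f)" "openin (subtopology (Spec M) U) (D (f \<otimes> x))"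
        using f sub by (auto intro!: opn)
      have "res F (D x) (D (f \<otimes> x)) e\<^sub>1 =
          act F (D (f \<otimes> x)) (frac (D (f \<otimes> x)) (x [^] j\<^sub>0) (x [^] r\<^sub>0)) (res F (D x) (D (f \<otimes> x)) e\<^sub>x)"
        unfolding e\<^sub>1_def using opn_x op sub D_pow[of x] generator_in_sec[OF e\<^sub>x]
        by (simp add: res_act bres_frac frac_closed)
      also have "\<dots> = act F (D (f \<otimes> x)) (frac (D (f \<otimes> x)) (x [^] j\<^sub>0 \<otimes> x [^] r) (x [^] r\<^sub>0 \<otimes> x [^] j))
          (res F (D f) (D (f \<otimes> x)) e)"
        unfolding eq using op sub subs f
        by (simp add: frac_closed res_closed mult_frac flip: act_mult)
      \<comment> \<open>Independence of the exponent: \<open>r\<^sub>0 - j\<^sub>0\<close> equals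
        \<open>r - j\<close>, so the remaining fraction is one.\<close>
      also have "x [^] r\<^sub>0 \<otimes> x [^] j = x [^] j\<^sub>0 \<otimes> x [^] r"
        using adapted_compatible(1)[OF 0 that] by (simp add: nat_pow_mult add.commute)
      also have "frac (D (f \<otimes> x)) (x [^] j\<^sub>0 \<otimes> x [^] r) (x [^] j\<^sub>0 \<otimes> x [^] r) = \<one>\<^bsub>sections (D (f \<otimes> x))\<^esub>"
        using subs by (intro frac_one) (auto simp: basic_open_mult)
      also have "act F (D (f \<otimes> x)) \<dots> (res F (D f) (D (f \<otimes> x)) e) = res F (D f) (D (f \<otimes> x)) e"
        using op sub f by (simp add: act_one res_closed)
      finally show ?thesis by (simp add: basic_open_mult)
    qed
    \<comment> \<open>All adapted generators enter at once; by compatibility no selection among them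
      is required.\<close>
    let ?\<G> = "insert (D x, e\<^sub>1) {(D f, e) | f e. \<exists>r j. adapted f e r j}"
    show ?thesis
    proof (rule glue_generators[of ?\<G> U])
      show "openin (subtopology (Spec M) U) W \<and> gen W e" if "(W, e) \<in> ?\<G>" for W e
        using that gen1 opn_x opn by (auto simp: adapted_def)
      show "res F W (W \<inter> W') e = res F W' (W \<inter> W') e'"
        if "(W, e) \<in> ?\<G>" "(W', e') \<in> ?\<G>" for W e W' e'
      proof -
        have "(W = D x \<and> e = e\<^sub>1) \<or> (\<exists>f r j. W = D f \<and> adapted f e r j)"
          "(W' = D x \<and> e' = e\<^sub>1) \<or> (\<exists>f r j. W' = D f \<and> adapted f e' r j)"
          using that by auto
        then show ?thesis
          using compat1 adapted_compatible(2) by (elim disjE exE conjE) (simp_all add: Int_commute)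
      qed
      show "\<Union>(fst ` ?\<G>) = U"
      proof
        show "\<Union>(fst ` ?\<G>) \<subseteq> U" using x_U by (auto simp: adapted_def)
        show "U \<subseteq> \<Union>(fst ` ?\<G>)"
        proof
          fix P assume P: "P \<in> U"
          show "P \<in> \<Union>(fst ` ?\<G>)"
          proof (cases "P \<in> D x")
            case False
            then obtain f e r j where "P \<in> D f" "adapted f e r j" using ex P by blast
            then have "(D f, e) \<in> ?\<G>" "P \<in> fst (D f, e)" by auto
            then show ?thesis using UnionI[OF imageI] by blast
          qed simp
        qed
      qed
    qed (rule that)
  qed
qed

end

context prime_element_binoid
begin

theorem invertible_sheaf_generated:
  fixes F :: "('a set, 'a set \<Rightarrow> ('a \<times> 'a) set, 's) act_presheaf"
  assumes U: "openin (Spec M) U" and x_U: "basic_open M x \<subseteq> U"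
    and F: "invertible_sheaf (subtopology (Spec M) U) (structure_sheaf M) F"
  obtains e where "generator (subtopology (Spec M) U) (structure_sheaf M) F U e"
proof -
  let ?X = "subtopology (Spec M) U"
  let ?gen = "generator ?X (structure_sheaf M) F"
  interpret binoid_sheaf ?X "structure_sheaf M" using U by (rule binoid_sheaf_structure_sheaf)
  interpret act_sheaf ?X "structure_sheaf M" F
    by unfold_locales (use F in \<open>simp add: invertible_sheaf_def\<close>)
  have openX: "openin ?X V \<longleftrightarrow> openin (Spec M) V \<and> V \<subseteq> U" for V
    by (rule openin_open_subtopology[OF U])
  have top: "topspace ?X = U" using U openin_subset by (auto simp: topspace_subtopology)
  have local: "\<exists>V e. openin (Spec M) V \<and> V \<subseteq> U \<and> P \<in> V \<and> ?gen V e" if P: "P \<in> U" for P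
  proof -
    obtain V where V: "openin ?X V" "P \<in> V"
      "act_presheaf_isomorphic (subtopology ?X V) (structure_sheaf M) F (regular_act (structure_sheaf M))"
      using F[unfolded invertible_sheaf_def top, THEN conjunct2, THEN bspec, OF P] by (elim exE conjE)
    obtain e where "?gen V e" using generator_of_isomorphic[OF V(1,3)] .
    then show ?thesis using V(1,2) openX by blast
  qed
  \<comment> \<open>A neighbourhood of the greatest point of \<open>D x\<close> on which
    \<open>F\<close> is trivial contains all of \<open>D x\<close>, so triviality there comes from a
    single point.\<close>
  have "top_prime x \<in> U" using top_prime_in_basic_open[OF x_nonabsorb] x_U by blast
  then obtain V e where V: "openin (Spec M) V" "V \<subseteq> U" "top_prime x \<in> V" "?gen V e"
    using local by blast
  have "basic_open M x \<subseteq> V" by (rule basic_open_subset_of_top_prime[OF V(1) x_carrier V(3)])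
  then have "?gen (basic_open M x) (res F V (basic_open M x) e)"
    using V x_U by (intro generator_restrict) (auto simp: openX openin_basic_open x_carrier)
  then interpret sheaf_at_prime_element M x U F "res F V (basic_open M x) e"
    using U x_U by unfold_locales
  have "\<exists>f\<in>carrier M. P \<in> D f \<and> D f \<subseteq> U \<and> (\<exists>e. gen (D f) e)" if P: "P \<in> U" for P
  proof -
    obtain V e where V: "openin (Spec M) V" "V \<subseteq> U" "P \<in> V" "?gen V e" using local[OF P] by blast
    then obtain f where f: "f \<in> carrier M" "P \<in> D f" "D f \<subseteq> V" by (auto simp: openin_Spec_iff)
    then have "gen (D f) (res F V (D f) e)"
      using V by (intro generator_restrict) (auto simp: openX openin_basic_open)
    then show ?thesis using f V by blast
  qed
  then show ?thesis using global_generator that by blast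
qed

text \<open>A prime consists of nonunits, so one different from the maximal ideal misses some
  nonunit \<open>f\<close>; the set \<open>D f\<close> then excludes the maximal ideal, which
  contains \<open>f\<close>.\<close>

lemma openin_punctured: "openin (Spec M) (punctured M)"
  unfolding openin_Spec_iff
proof (intro conjI ballI)
  fix P assume P: "P \<in> punctured M"
  then have prime: "prime_ideal M P" "P \<noteq> carrier M - Units M" by (auto simp: punctured_def)
  have "P \<subseteq> carrier M - Units M"
  proof
    fix a assume a: "a \<in> P"
    then have ac: "a \<in> carrier M" using prime by (auto simp: prime_ideal_def)
    have "a \<notin> Units M"
    proof
      assume "a \<in> Units M"
      then obtain b where "b \<in> carrier M" "a \<otimes> b = \<one>" by (auto simp: Units_def)
      then show False using a ac prime prime_ideal_mult_iff[of P a b] prime_ideal_one by auto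
    qed
    then show "a \<in> carrier M - Units M" using ac by blast
  qed
  then obtain f where f: "f \<in> carrier M" "f \<notin> Units M" "f \<notin> P" using prime by blast
  then show "\<exists>f\<in>carrier M. P \<in> basic_open M f \<and> basic_open M f \<subseteq> punctured M"
    using prime by (intro bexI[of _ f]) (auto simp: basic_open_def punctured_def)
qed (auto simp: punctured_def)

theorem trivial_Pic_loc: "trivial_group (Pic_loc TYPE('c) M)"
proof -
  let ?X = "subtopology (Spec M) (punctured M)"
  interpret binoid_sheaf ?X "structure_sheaf M"
    by (rule binoid_sheaf_structure_sheaf[OF openin_punctured])
  \<comment> \<open>The maximal ideal contains the nonunit \<open>x\<close>, so it is not a point of
    \<open>D x\<close>.\<close>
  have "basic_open M x \<subseteq> punctured M"
    using x_prime x_carrier by (auto simp: basic_open_def punctured_def Divisibility.prime_def)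
  moreover have "topspace ?X = punctured M"
    using openin_subset[OF openin_punctured] by (auto simp: topspace_subtopology)
  ultimately have "\<exists>e. generator ?X (structure_sheaf M) L (topspace ?X) e"
    if "invertible_sheaf ?X (structure_sheaf M) L"
    for L :: "('a set, 'a set \<Rightarrow> ('a \<times> 'a) set, ('a set \<Rightarrow> ('a \<times> 'a) set) + 'c) act_presheaf"
    by (metis invertible_sheaf_generated[OF openin_punctured _ that])
  then show ?thesis unfolding Pic_loc_def by (rule trivial_Pic)
qed

end

section \<open>Smash product with the natural numbers\<close>

context integral_cancellative_binoid
begin

abbreviation "smash_nat \<equiv> smash M (adjoin_absorb nat_monoid)"

text \<open>\<open>smash_elem a n\<close> is the absorbing element when \<open>a\<close> is.\<close>

definition smash_elem :: "'a \<Rightarrow> nat \<Rightarrow> ('a \<times> nat option) set" where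
  "smash_elem a n = smash_rel M (adjoin_absorb nat_monoid) `` {(a, Some n)}"

definition smash_zero :: "('a \<times> nat option) set" where
  "smash_zero = {(a, b). a \<in> carrier M \<and> (a = absorb M \<or> b = None)}"

lemma carrier_adjoin_nat: "carrier (adjoin_absorb nat_monoid) = UNIV"
  by (auto simp: adjoin_absorb_def nat_monoid_def) (metis not_None_eq rangeI)

lemma smash_class_zero:
  "a \<in> carrier M \<Longrightarrow> a = absorb M \<or> b = None \<Longrightarrow>
     smash_rel M (adjoin_absorb nat_monoid) `` {(a, b)} = smash_zero"
  by (auto simp: smash_rel_def smash_zero_def carrier_adjoin_nat)
    (auto simp: adjoin_absorb_def)

lemma smash_elem_absorb: "smash_elem (absorb M) n = smash_zero"
  unfolding smash_elem_def by (rule smash_class_zero) (simp_all add: absorb_closed)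

lemma smash_elem_nonabsorb: "a \<in> nonabsorb M \<Longrightarrow> smash_elem a n = {(a, Some n)}"
  by (auto simp: smash_elem_def smash_rel_def nonabsorb_def carrier_adjoin_nat)
    (auto simp: adjoin_absorb_def)

lemma smash_elem_eq_iff:
  assumes "a \<in> carrier M" "b \<in> carrier M"
  shows "smash_elem a m = smash_elem b n \<longleftrightarrow> a = b \<and> (a = absorb M \<or> m = n)"
proof -
  have "(c, Some k) \<notin> smash_zero" if "c \<in> nonabsorb M" for c k
    using that by (auto simp: smash_zero_def nonabsorb_def)
  then have "smash_zero \<noteq> {(c, Some k)}" if "c \<in> nonabsorb M" for c k
    using that by blast
  moreover have "a = absorb M \<or> a \<in> nonabsorb M" "b = absorb M \<or> b \<in> nonabsorb M"
    using assms by (auto simp: nonabsorb_def)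
  moreover have "absorb M \<notin> nonabsorb M" by (simp add: nonabsorb_def)
  ultimately show ?thesis
    by (elim disjE) (auto simp: smash_elem_absorb smash_elem_nonabsorb)
qed

text \<open>A pair with second entry \<open>None\<close> lies in the zero class, which is also
  \<open>smash_elem (absorb M) k\<close>, so a natural exponent suffices for every class.\<close>

lemma carrier_smash: "carrier smash_nat = {smash_elem a n | a n. a \<in> carrier M}"
proof -
  have "\<exists>c k. smash_rel M (adjoin_absorb nat_monoid) `` {(a, b)} = smash_elem c k \<and> c \<in> carrier M"
    if "a \<in> carrier M" for a b
  proof (cases b)
    case None
    then show ?thesis
      using that smash_class_zero[of a None] smash_elem_absorb absorb_closed by metis
  next
    case (Some k)
    then show ?thesis using that smash_elem_def by blast
  qed
  then show ?thesis
    by (auto simp: smash_def quotient_binoid_def prod_binoid_def quotient_def carrier_adjoin_nat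
        smash_elem_def[symmetric]) (auto simp: smash_elem_def)
qed

text \<open>If a factor is the zero class, every product of representatives has an absorbing entry
  and the union collapses to \<open>smash_zero\<close>. Otherwise both classes are
  singletons.\<close>

lemma mult_smash:
  assumes a: "a \<in> carrier M" and b: "b \<in> carrier M"
  shows "smash_elem a m \<otimes>\<^bsub>smash_nat\<^esub> smash_elem b n = smash_elem (a \<otimes> b) (m + n)"
proof -
  let ?N = "adjoin_absorb nat_monoid"
  let ?p = "\<lambda>x y. smash_rel M ?N `` {(fst x \<otimes> fst y, snd x \<otimes>\<^bsub>?N\<^esub> snd y)}"
  have mult: "smash_elem a m \<otimes>\<^bsub>smash_nat\<^esub> smash_elem b n =
      (\<Union>x\<in>smash_elem a m. \<Union>y\<in>smash_elem b n. ?p x y)"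
    by (simp add: smash_def quotient_binoid_def prod_binoid_def)
  have closed: "fst x \<in> carrier M" if "x \<in> smash_elem c k" for x c k
    using that by (auto simp: smash_elem_def smash_rel_def)
  have zero: "?p x y = smash_zero" "?p y x = smash_zero"
    if "x \<in> smash_zero" "y \<in> smash_elem c k" for x y c k
    using that closed[OF that(2)]
    by (intro smash_class_zero;
        auto simp: smash_zero_def absorb_mult mult_absorb adjoin_absorb_def split: option.splits)+
  have ne: "smash_elem c k \<noteq> {}" if "c \<in> carrier M" for c k
    using that by (auto simp: smash_elem_def smash_rel_def carrier_adjoin_nat)
  show ?thesis
  proof (cases "a = absorb M \<or> b = absorb M")
    case True
    then have "?p x y = smash_zero" if "x \<in> smash_elem a m" "y \<in> smash_elem b n" for x y
      using that zero by (metis smash_elem_absorb)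
    then have "(\<Union>x\<in>smash_elem a m. \<Union>y\<in>smash_elem b n. ?p x y) = smash_zero"
      using ne a b by (simp cong: SUP_cong)
    moreover have "a \<otimes> b = absorb M" using True a b by (auto simp: absorb_mult mult_absorb)
    ultimately show ?thesis unfolding mult by (simp add: smash_elem_absorb)
  next
    case False
    then have "a \<in> nonabsorb M" "b \<in> nonabsorb M" using a b by (auto simp: nonabsorb_def)
    then show ?thesis
      unfolding mult
      by (simp add: smash_elem_nonabsorb)
        (simp add: smash_elem_def adjoin_absorb_def nat_monoid_def)
  qed
qed

lemma one_smash: "\<one>\<^bsub>smash_nat\<^esub> = smash_elem \<one> 0"
  by (simp add: smash_def quotient_binoid_def prod_binoid_def smash_elem_def)
    (simp add: adjoin_absorb_def nat_monoid_def)

lemma absorb_smash: "absorb smash_nat = smash_elem (absorb M) 0"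
proof -
  have "absorb smash_nat = smash_rel M (adjoin_absorb nat_monoid) `` {(absorb M, None)}"
    by (simp add: smash_def quotient_binoid_def prod_binoid_def) (simp add: adjoin_absorb_def)
  then show ?thesis by (simp add: smash_class_zero smash_elem_absorb absorb_closed)
qed

lemma one_neq_absorb: "\<one> \<noteq> absorb M"
  using one_nonabsorb by (simp add: nonabsorb_def)

lemma mult_eq_absorb_iff:
  "a \<in> carrier M \<Longrightarrow> b \<in> carrier M \<Longrightarrow> a \<otimes> b = absorb M \<longleftrightarrow> a = absorb M \<or> b = absorb M"
  using nonabsorb_mult[of a b] by (auto simp: nonabsorb_def absorb_mult mult_absorb)

lemma smash_carrierE:
  assumes "X \<in> carrier smash_nat"
  obtains a n where "X = smash_elem a n" "a \<in> carrier M"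
  using assms carrier_smash by auto

lemma smash_elem_closed: "a \<in> carrier M \<Longrightarrow> smash_elem a n \<in> carrier smash_nat"
  using carrier_smash by auto

lemma nonabsorb_smash: "nonabsorb smash_nat = {smash_elem a n | a n. a \<in> nonabsorb M}"
proof -
  have "smash_elem a n \<noteq> absorb smash_nat \<longleftrightarrow> a \<noteq> absorb M" if "a \<in> carrier M" for a n
    using that by (simp add: absorb_smash smash_elem_eq_iff absorb_closed)
  then show ?thesis
    unfolding nonabsorb_def carrier_smash by blast
qed

lemma binoid_smash: "binoid smash_nat"
proof -
  have "comm_monoid smash_nat"
  proof (rule comm_monoidI)
    fix X Y Z assume "X \<in> carrier smash_nat" "Y \<in> carrier smash_nat" "Z \<in> carrier smash_nat"
    then obtain a b c m n k where "X = smash_elem a m" "Y = smash_elem b n" "Z = smash_elem c k"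
      "a \<in> carrier M" "b \<in> carrier M" "c \<in> carrier M" by (metis smash_carrierE)
    then show "X \<otimes>\<^bsub>smash_nat\<^esub> Y \<otimes>\<^bsub>smash_nat\<^esub> Z = X \<otimes>\<^bsub>smash_nat\<^esub> (Y \<otimes>\<^bsub>smash_nat\<^esub> Z)"
      by (simp add: mult_smash m_assoc add.assoc)
  qed (auto elim!: smash_carrierE
      simp: mult_smash one_smash smash_elem_closed m_comm add.commute)
  moreover have "absorb smash_nat \<otimes>\<^bsub>smash_nat\<^esub> X = absorb smash_nat" if "X \<in> carrier smash_nat" for X
    using that
    by (elim smash_carrierE)
      (simp add: absorb_smash mult_smash absorb_closed absorb_mult smash_elem_eq_iff)
  ultimately show ?thesis
    by (simp add: binoid_def binoid_axioms_def absorb_smash smash_elem_closed absorb_closed)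
qed

lemma integral_cancellative_smash: "integral_cancellative_binoid smash_nat"
proof -
  have "integral_binoid smash_nat"
    unfolding integral_binoid_def
  proof
    show "nonabsorb smash_nat \<subseteq> carrier smash_nat" by (auto simp: nonabsorb_def)
    show "\<one>\<^bsub>smash_nat\<^esub> \<in> nonabsorb smash_nat"
      using one_nonabsorb by (auto simp: nonabsorb_smash one_smash)
    fix X Y assume "X \<in> nonabsorb smash_nat" "Y \<in> nonabsorb smash_nat"
    then obtain a b m n where "X = smash_elem a m" "Y = smash_elem b n"
      "a \<in> nonabsorb M" "b \<in> nonabsorb M" by (auto simp: nonabsorb_smash)
    then show "X \<otimes>\<^bsub>smash_nat\<^esub> Y \<in> nonabsorb smash_nat"
      using nonabsorb_mult by (auto simp: nonabsorb_smash mult_smash nonabsorb_carrier)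
  qed
  moreover have "cancellative smash_nat"
    unfolding cancellative_def
  proof (intro ballI impI)
    fix X Y Z
    assume "X \<in> carrier smash_nat" "Y \<in> carrier smash_nat" "Z \<in> carrier smash_nat"
      and *: "X \<otimes>\<^bsub>smash_nat\<^esub> Y = X \<otimes>\<^bsub>smash_nat\<^esub> Z \<and> X \<otimes>\<^bsub>smash_nat\<^esub> Z \<noteq> absorb smash_nat"
    then obtain a b c m n k where eq: "X = smash_elem a m" "Y = smash_elem b n" "Z = smash_elem c k"
      and abc: "a \<in> carrier M" "b \<in> carrier M" "c \<in> carrier M" by (metis smash_carrierE)
    have "a \<otimes> c \<noteq> absorb M" "a \<otimes> b = a \<otimes> c" "m + n = m + k"
      using * abc unfolding eq
      by (auto simp: mult_smash absorb_smash smash_elem_eq_iff absorb_closed)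
    moreover from this have "a \<in> nonabsorb M"
      using abc by (auto simp: nonabsorb_def absorb_mult)
    ultimately show "Y = Z" using nonabsorb_cancel[of a b c] abc by (simp add: eq)
  qed
  ultimately show ?thesis
    using binoid_smash
    by (simp add: integral_cancellative_binoid_def integral_cancellative_binoid_axioms_def)
qed

lemma prime_element_smash: "prime_element_binoid smash_nat (smash_elem \<one> (Suc 0))"
proof -
  interpret S: integral_cancellative_binoid smash_nat by (rule integral_cancellative_smash)
  let ?x = "smash_elem \<one> (Suc 0)"
  \<comment> \<open>Divisibility by the generator is read off from the exponent. Primality follows,
    since a sum of two exponents is positive only if one of them is.\<close>
  have dvd_iff: "?x divides\<^bsub>smash_nat\<^esub> smash_elem a n \<longleftrightarrow> a = absorb M \<or> 1 \<le> n"
    if a: "a \<in> carrier M" for a n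
  proof
    assume "?x divides\<^bsub>smash_nat\<^esub> smash_elem a n"
    then obtain b k where "b \<in> carrier M" "smash_elem a n = ?x \<otimes>\<^bsub>smash_nat\<^esub> smash_elem b k"
      by (auto simp: factor_def elim!: smash_carrierE)
    then show "a = absorb M \<or> 1 \<le> n" using a by (auto simp: mult_smash smash_elem_eq_iff)
  next
    assume "a = absorb M \<or> 1 \<le> n"
    \<comment> \<open>The truncated \<open>n - 1\<close> at \<open>n = 0\<close> is harmless: it
      occurs only for \<open>a = absorb M\<close>, where the exponent is irrelevant.\<close>
    then have "smash_elem a n = ?x \<otimes>\<^bsub>smash_nat\<^esub> smash_elem a (n - 1)"
      using a by (auto simp: mult_smash smash_elem_eq_iff)
    then show "?x divides\<^bsub>smash_nat\<^esub> smash_elem a n"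
      using a smash_elem_closed by (auto simp: factor_def)
  qed
  have pow: "?x [^]\<^bsub>smash_nat\<^esub> n = smash_elem \<one> n" for n :: nat
    by (induction n) (simp_all add: one_smash mult_smash)
  show ?thesis
  proof
    show "?x \<in> nonabsorb smash_nat" using one_nonabsorb by (auto simp: nonabsorb_smash)
    have "\<not> ?x divides\<^bsub>smash_nat\<^esub> \<one>\<^bsub>smash_nat\<^esub>"
      unfolding one_smash by (simp add: dvd_iff one_neq_absorb del: One_nat_def)
    then have "?x \<notin> Units smash_nat" by (auto simp: factor_def Units_def)
    moreover have "?x divides\<^bsub>smash_nat\<^esub> X \<or> ?x divides\<^bsub>smash_nat\<^esub> Y"
      if "X \<in> carrier smash_nat" "Y \<in> carrier smash_nat" "?x divides\<^bsub>smash_nat\<^esub> (X \<otimes>\<^bsub>smash_nat\<^esub> Y)"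
      for X Y
    proof -
      obtain a b m n where "X = smash_elem a m" "Y = smash_elem b n" "a \<in> carrier M" "b \<in> carrier M"
        using \<open>X \<in> _\<close> \<open>Y \<in> _\<close> by (metis smash_carrierE)
      then show ?thesis using that(3) by (auto simp: mult_smash dvd_iff mult_eq_absorb_iff)
    qed
    ultimately show "Divisibility.prime smash_nat ?x" by (simp add: Divisibility.prime_def)
    fix X assume "X \<in> nonabsorb smash_nat"
    then obtain a n where "X = smash_elem a n" "a \<in> nonabsorb M" by (auto simp: nonabsorb_smash)
    moreover from this have "a \<in> carrier M" "a \<noteq> absorb M" by (auto simp: nonabsorb_def)
    ultimately show "\<exists>n::nat. \<exists>c\<in>carrier smash_nat. \<not> ?x divides\<^bsub>smash_nat\<^esub> c \<and>
        X = ?x [^]\<^bsub>smash_nat\<^esub> n \<otimes>\<^bsub>smash_nat\<^esub> c"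
      \<comment> \<open>The exponent is the valuation, and the factor prime to the generator is the
        copy of \<open>a\<close> in degree zero.\<close>
      by (intro exI[of _ n] bexI[of _ "smash_elem a 0"])
        (auto simp: pow mult_smash dvd_iff smash_elem_closed)
  qed
qed

end

theorem proposition1p123:
  fixes M :: "'a binoid"
  assumes "binoid M"
    and "finitely_generated M"
    and "integral_binoid M"
    and "cancellative M"
    and "torsion_free M"
    and "normal_binoid M"
    and "regular_in_codim_one M"
    and "binoid_dim M = 2"
  shows "trivial_group (Pic_loc TYPE('c) (smash M (adjoin_absorb nat_monoid)))"
proof -
  interpret integral_cancellative_binoid M
    using assms by (simp add: integral_cancellative_binoid_def integral_cancellative_binoid_axioms_def)
  show ?thesis using prime_element_smash by (rule prime_element_binoid.trivial_Pic_loc)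
qed

end
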